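(* Let $k$ be a field and let $N$ be a positive integer. Any upper bound for the projective dimension of an ideal supported on $N$ monomials, counted with multiplicity, is at least $2^{N/2}$. That is, if $B$ is a real number such that $\operatorname{pd} R/I \leq B$ for every polynomial ring $R$ over $k$ in finitely many variables (the number of variables being arbitrary) and every homogeneous ideal $I \subseteq R$ that has a monomial support of $N$ monomials, counted with multiplicity, then $B \geq 2^{N/2}$.
   Context: For a homogeneous ideal $I$ in a polynomial ring $R$ over a field, a monomial support of $I$ is the collection of monomials that appear as terms (with nonzero coefficient) in a set of minimal homogeneous generators of $I$; it depends on the choice of minimal generators. Saying that $I$ has a monomial support of $N$ monomials counted with multiplicity (or is supported on $N$ monomials counted with multiplicity) means that there is a minimal system of homogeneous generators $f_1,\dots,f_r$ of $I$ such that the sum over $i = 1, \dots, r$ of the number of monomials appearing in $f_i$ with nonzero coefficient equals $N$ (a monomial appearing in several generators is counted once for each). The projective dimension in question is $\operatorname{pd} R/I$, the projective dimension of $R/I$ as an $R$-module. The degrees of the generators are not restricted.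
   Formalization: The formal theorem assumes N at least 2: for N = 1 the claim is false, since an ideal supported on one monomial m is (m) with pd R/(m) at most 1, so B = 1 is an upper bound but 1 < 2^{1/2}. *)

theory Defs
  imports
    Complex_Main
    "HOL-Library.Extended_Real"
    "HOL-Library.Poly_Mapping"
    "HOL-Algebra.Module"
    "HOL-Algebra.QuotRing"
begin

section \<open>Projective dimension\<close>

definition module_hom ::
    "('r, 's) ring_scheme \<Rightarrow> ('r, 'a, 'x) module_scheme \<Rightarrow> ('r, 'b, 'y) module_scheme \<Rightarrow> ('a \<Rightarrow> 'b) set"
  where "module_hom R M N =
    {f \<in> carrier M \<rightarrow> carrier N.
       (\<forall>x\<in>carrier M. \<forall>y\<in>carrier M. f (x \<oplus>\<^bsub>M\<^esub> y) = f x \<oplus>\<^bsub>N\<^esub> f y) \<and>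
       (\<forall>a\<in>carrier R. \<forall>x\<in>carrier M. f (a \<odot>\<^bsub>M\<^esub> x) = a \<odot>\<^bsub>N\<^esub> f x)}"

text \<open>
  The lifting property, tested on epimorphisms \<open>g : A \<rightarrow> C\<close> with \<open>C\<close> on the type of \<open>P\<close> and
  \<open>A\<close> on functions from that type to the ring. This is no restriction: the canonical epimorphism
  from the free module on the underlying set of \<open>P\<close> onto \<open>P\<close> is among these, so the property
  makes \<open>P\<close> a direct summand of a free module.
\<close>

definition projective_module :: "('r, 's) ring_scheme \<Rightarrow> ('r, 'p) module \<Rightarrow> bool"
  where "projective_module R P \<longleftrightarrow>
    module R P \<and>
    (\<forall>(A :: ('r, 'p \<Rightarrow> 'r) module) (C :: ('r, 'p) module) g f.
       module R A \<longrightarrow> module R C \<longrightarrow>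
       g \<in> module_hom R A C \<longrightarrow> g ` carrier A = carrier C \<longrightarrow>
       f \<in> module_hom R P C \<longrightarrow>
       (\<exists>h \<in> module_hom R P A. \<forall>x\<in>carrier P. g (h x) = f x))"

text \<open>
  An exact sequence \<open>\<dots> \<rightarrow> P 2 \<rightarrow> P 1 \<rightarrow> P 0 \<rightarrow> M \<rightarrow> 0\<close> with all \<open>P i\<close> projective, where
  \<open>D i : P (Suc i) \<rightarrow> P i\<close> and \<open>\<epsilon> : P 0 \<rightarrow> M\<close>.
\<close>

definition projective_resolution ::
    "('r, 's) ring_scheme \<Rightarrow> ('r, 'm) module \<Rightarrow>
     (nat \<Rightarrow> ('r, 'p) module) \<Rightarrow> (nat \<Rightarrow> 'p \<Rightarrow> 'p) \<Rightarrow> ('p \<Rightarrow> 'm) \<Rightarrow> bool"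
  where "projective_resolution R M P D \<epsilon> \<longleftrightarrow>
    (\<forall>i. projective_module R (P i)) \<and>
    (\<forall>i. D i \<in> module_hom R (P (Suc i)) (P i)) \<and>
    \<epsilon> \<in> module_hom R (P 0) M \<and>
    \<epsilon> ` carrier (P 0) = carrier M \<and>
    D 0 ` carrier (P 1) = a_kernel (P 0) M \<epsilon> \<and>
    (\<forall>i. D (Suc i) ` carrier (P (Suc (Suc i))) = a_kernel (P (Suc i)) (P i) (D i))"

text \<open>
  The resolving modules live on functions from \<open>('m \<times> 'r) list\<close> to \<open>'r\<close>. This type is large
  enough to compute the projective dimension of any \<open>R\<close>-module on \<open>'m\<close>: take the free module on
  the underlying set of \<open>M\<close>, then the free module on the underlying set of the kernel, and so on,
  replacing one of the free modules by the kernel itself once it is projective. All the generating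
  sets that occur inject into \<open>('m \<times> 'r) list\<close>. The zero module gets the value \<open>-\<infinity>\<close>.
\<close>

definition proj_dim :: "('r, 's) ring_scheme \<Rightarrow> ('r, 'm) module \<Rightarrow> ereal"
  where "proj_dim R M =
    (if carrier M = {\<zero>\<^bsub>M\<^esub>} then -\<infinity>
     else Inf {ereal (real d) | d.
       \<exists>(P :: nat \<Rightarrow> ('r, ('m \<times> 'r) list \<Rightarrow> 'r) module) D \<epsilon>.
         projective_resolution R M P D \<epsilon> \<and> (\<forall>i>d. carrier (P i) = {\<zero>\<^bsub>P i\<^esub>})})"

definition quotient_module :: "('r, 's) ring_scheme \<Rightarrow> 'r set \<Rightarrow> ('r, 'r set) module"
  where "quotient_module R I =
    \<lparr>carrier = carrier (R Quot I), mult = mult (R Quot I), one = one (R Quot I),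
     zero = zero (R Quot I), add = add (R Quot I),
     smult = (\<lambda>a C. (I +>\<^bsub>R\<^esub> a) \<otimes>\<^bsub>R Quot I\<^esub> C)\<rparr>"


section \<open>Polynomial rings and monomial supports\<close>

type_synonym 'k mpol = "(nat \<Rightarrow>\<^sub>0 nat) \<Rightarrow>\<^sub>0 'k"

text \<open>
  The polynomial ring in the \<open>n\<close> variables with indices \<open>0, \<dots>, n - 1\<close>. The keys of a polynomial
  are the exponent vectors of its monomials with nonzero coefficient, and the keys of an exponent
  vector are the variables that occur in the monomial.
\<close>

definition mpoly_ring :: "nat \<Rightarrow> 'k::field mpol ring"
  where "mpoly_ring n =
    \<lparr>carrier = {p. \<forall>m\<in>Poly_Mapping.keys p. Poly_Mapping.keys m \<subseteq> {..<n}},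
     mult = (*), one = 1, zero = 0, add = (+)\<rparr>"

definition monomial_degree :: "(nat \<Rightarrow>\<^sub>0 nat) \<Rightarrow> nat"
  where "monomial_degree m = (\<Sum>i\<in>Poly_Mapping.keys m. Poly_Mapping.lookup m i)"

definition homogeneous :: "'k::field mpol \<Rightarrow> bool"
  where "homogeneous p \<longleftrightarrow> (\<exists>d. \<forall>m\<in>Poly_Mapping.keys p. monomial_degree m = d)"

definition homogeneous_ideal :: "nat \<Rightarrow> 'k::field mpol set \<Rightarrow> bool"
  where "homogeneous_ideal n I \<longleftrightarrow>
    (\<exists>S \<subseteq> carrier (mpoly_ring n). (\<forall>f\<in>S. homogeneous f) \<and> I = Idl\<^bsub>mpoly_ring n\<^esub> S)"

definition minimal_homogeneous_generators :: "nat \<Rightarrow> 'k::field mpol set \<Rightarrow> 'k mpol set \<Rightarrow> bool"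
  where "minimal_homogeneous_generators n I F \<longleftrightarrow>
    finite F \<and> F \<subseteq> carrier (mpoly_ring n) \<and> (\<forall>f\<in>F. homogeneous f) \<and>
    Idl\<^bsub>mpoly_ring n\<^esub> F = I \<and> (\<forall>G. G \<subset> F \<longrightarrow> Idl\<^bsub>mpoly_ring n\<^esub> G \<noteq> I)"

text \<open>
  Each generator contributes all its monomials, so a monomial shared by several generators is
  counted once for each of them. If \<open>N = 1\<close> then \<open>I\<close> is generated by one monomial and \<open>R/I\<close> has
  projective dimension at most \<open>1 < 2 powr (1 / 2)\<close>: a lower bound of \<open>2 powr (N / 2)\<close> for all upper
  bounds can hold only from \<open>N = 2\<close> on.
\<close>

definition has_monomial_support :: "nat \<Rightarrow> 'k::field mpol set \<Rightarrow> nat \<Rightarrow> bool"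
  where "has_monomial_support n I N \<longleftrightarrow>
    (\<exists>F. minimal_homogeneous_generators n I F \<and> (\<Sum>f\<in>F. card (Poly_Mapping.keys f)) = N)"

end

theory Submission
  imports Defs
begin

text \<open>
  If \<open>R/I\<close> has a nonzero socle element, then its projective dimension is at least the number \<open>n\<close> of
  variables: the Koszul complex on the variables is acyclic in positive degrees on projective modules,
  so a top-degree Koszul cycle of \<open>R/I\<close> could be pushed through a resolution shorter than \<open>n\<close> and
  would have to vanish. Now suppose \<open>f\<close> is a socle element modulo \<open>I\<close>. Substitute \<open>x\<^sub>i y\<^sub>i\<close> for \<open>x\<^sub>i\<close>
  in the generators of \<open>I\<close> and add the binomial \<open>\<Prod>x\<^sub>i - \<Prod>y\<^sub>i\<close>. Modulo the new ideal,
  \<open>f(x y) \<Prod>x\<^sub>i = f(x y) \<Prod>y\<^sub>i\<close> is killed by every \<open>y\<^sub>i\<close> and every \<open>x\<^sub>i\<close>, because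
  \<open>x\<^sub>i y\<^sub>i f(x y)\<close> lies in it. Two more monomials thus double the number of variables. Starting from
  \<open>(x\<^sub>1, x\<^sub>2)\<close> or \<open>(x\<^sub>1, x\<^sub>2, x\<^sub>3)\<close> with \<open>f = 1\<close> gives the bound.
\<close>

section \<open>Koszul complexes\<close>

text \<open>The modules of a resolution are arbitrary projectives: no minimality, no finite rank. So
  no Betti number is counted; instead the chase runs in the double complex formed by the Koszul
  complexes of all \<open>P i\<close>. Each step lowers the Koszul degree by one and raises the
  resolution index by one. The sum stays \<open>n > d\<close>, hence the index passes
  \<open>d\<close>, where the modules vanish, before the Koszul degree can become negative. Coming
  back, acyclicity is used only in positive degrees.

  In the doubling, the difficulty is to show that elements lie outside an ideal: the new socle
  element, and each generator relative to the others. One family of linear maps,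
  \<open>halve_vars n C\<close>, certifies all of it, with \<open>C\<close> the odd numbers, the
  even numbers or \<open>{1}\<close>.

  Doubling adds 2 to the count, so the parity of \<open>N\<close> is decided at the start; this is
  why two starting ideals are needed.\<close>

text \<open>
  The Koszul complex on \<open>xs\<close>, built up one variable at a time: a chain assigns a coefficient to each
  subset of \<open>xs\<close>, encoded as a list of Booleans. The minus sign in the last equation makes it a complex.
\<close>

fun koszul :: "('r, 'm, 'x) module_scheme \<Rightarrow> 'r list \<Rightarrow> (bool list \<Rightarrow> 'm) \<Rightarrow> bool list \<Rightarrow> 'm" where
  "koszul M [] c s = \<zero>\<^bsub>M\<^esub>"
| "koszul M (x # xs) c [] = \<zero>\<^bsub>M\<^esub>"
| "koszul M (x # xs) c (False # s) =
     koszul M xs (\<lambda>t. c (False # t)) s \<oplus>\<^bsub>M\<^esub> x \<odot>\<^bsub>M\<^esub> c (True # s)"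
| "koszul M (x # xs) c (True # s) = \<ominus>\<^bsub>M\<^esub> koszul M xs (\<lambda>t. c (True # t)) s"

text \<open>The degree is an integer, so that it can drop below 0 without a case distinction; all
  chains vanish there. Requiring zero on lists of the wrong length or count makes the graded pieces
  subsets of one function type.\<close>

definition koszul_chain :: "('r, 'm, 'x) module_scheme \<Rightarrow> nat \<Rightarrow> int \<Rightarrow> (bool list \<Rightarrow> 'm) set"
  where "koszul_chain M n i =
    {c. (\<forall>s. c s \<in> carrier M) \<and>
        (\<forall>s. c s \<noteq> \<zero>\<^bsub>M\<^esub> \<longrightarrow> length s = n \<and> int (count_list s True) = i)}"

text \<open>
  Weak regularity: \<open>x e \<in> (xs) M\<close> implies \<open>e \<in> (xs) M\<close>, where \<open>(xs) M\<close> is expressed as the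
  image of the Koszul differential in degree zero.
\<close>

fun koszul_regular :: "('r, 'm, 'x) module_scheme \<Rightarrow> 'r list \<Rightarrow> bool" where
  "koszul_regular M [] \<longleftrightarrow> True"
| "koszul_regular M (x # xs) \<longleftrightarrow> koszul_regular M xs \<and>
     (\<forall>a\<in>koszul_chain M (length xs) 1. \<forall>e\<in>koszul_chain M (length xs) 0.
        (\<forall>s. x \<odot>\<^bsub>M\<^esub> e s = koszul M xs a s) \<longrightarrow>
        (\<exists>b\<in>koszul_chain M (length xs) 1. \<forall>s. e s = koszul M xs b s))"

context module
begin

lemma koszul_closed:
  "set xs \<subseteq> carrier R \<Longrightarrow> (\<And>s. c s \<in> carrier M) \<Longrightarrow> koszul M xs c s \<in> carrier M"
proof (induction xs arbitrary: c s)
  case (Cons x xs)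
  then show ?case by (cases s; cases "hd s") auto
qed simp

lemma koszul_add:
  assumes "set xs \<subseteq> carrier R" "\<And>s. b s \<in> carrier M" "\<And>s. c s \<in> carrier M"
  shows "koszul M xs (\<lambda>s. b s \<oplus>\<^bsub>M\<^esub> c s) s = koszul M xs b s \<oplus>\<^bsub>M\<^esub> koszul M xs c s"
  using assms
proof (induction xs arbitrary: b c s)
  case Nil
  then show ?case by simp
next
  case (Cons x xs)
  show ?case
  proof (cases s)
    case Nil
    then show ?thesis by simp
  next
    case (Cons a t)
    have cl: "koszul M xs (\<lambda>t. b (a # t)) t \<in> carrier M" "koszul M xs (\<lambda>t. c (a # t)) t \<in> carrier M"
      using Cons.prems by (auto intro!: koszul_closed)
    have IH: "koszul M xs (\<lambda>t. b (a # t) \<oplus>\<^bsub>M\<^esub> c (a # t)) t =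
        koszul M xs (\<lambda>t. b (a # t)) t \<oplus>\<^bsub>M\<^esub> koszul M xs (\<lambda>t. c (a # t)) t"
      using Cons.prems by (intro Cons.IH) auto
    show ?thesis
      using Cons cl IH Cons.prems
      by (cases a) (simp_all add: smult_r_distr M.a_ac M.minus_add)
  qed
qed

lemma koszul_smult:
  assumes "set xs \<subseteq> carrier R" "r \<in> carrier R" "\<And>s. c s \<in> carrier M"
  shows "koszul M xs (\<lambda>s. r \<odot>\<^bsub>M\<^esub> c s) s = r \<odot>\<^bsub>M\<^esub> koszul M xs c s"
  using assms
proof (induction xs arbitrary: c s)
  case Nil
  then show ?case by simp
next
  case (Cons x xs)
  show ?case
  proof (cases s)
    case Nil
    with Cons.prems show ?thesis by simp
  next
    case (Cons a t)
    have cl: "koszul M xs (\<lambda>t. c (a # t)) t \<in> carrier M"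
      using Cons.prems by (auto intro!: koszul_closed)
    have IH: "koszul M xs (\<lambda>t. r \<odot>\<^bsub>M\<^esub> c (a # t)) t = r \<odot>\<^bsub>M\<^esub> koszul M xs (\<lambda>t. c (a # t)) t"
      using Cons.prems by (intro Cons.IH) auto
    have "x \<odot>\<^bsub>M\<^esub> (r \<odot>\<^bsub>M\<^esub> c (True # t)) = r \<odot>\<^bsub>M\<^esub> (x \<odot>\<^bsub>M\<^esub> c (True # t))"
      using Cons.prems by (simp add: smult_assoc1[symmetric] R.m_comm)
    then show ?thesis
      using Cons cl IH Cons.prems by (cases a) (simp_all add: smult_r_distr smult_r_minus)
  qed
qed

lemma koszul_uminus:
  assumes "set xs \<subseteq> carrier R" "\<And>s. c s \<in> carrier M"
  shows "koszul M xs (\<lambda>s. \<ominus>\<^bsub>M\<^esub> c s) s = \<ominus>\<^bsub>M\<^esub> koszul M xs c s"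
  using koszul_smult[of xs "\<ominus> \<one>" c s] assms by (simp add: smult_l_minus koszul_closed)

lemma koszul_zero: "set xs \<subseteq> carrier R \<Longrightarrow> koszul M xs (\<lambda>s. \<zero>\<^bsub>M\<^esub>) s = \<zero>\<^bsub>M\<^esub>"
  using koszul_smult[of xs "\<zero>" "\<lambda>s. \<zero>\<^bsub>M\<^esub>" s] by (simp add: koszul_closed)

text \<open>With \<open>c\<close> split into the parts \<open>F\<close> and \<open>T\<close> at
  heads \<open>False\<close> and \<open>True\<close>, the first component of the square is
  \<open>d (d F + x T) - x d T\<close>, where the two terms in \<open>x\<close> cancel. The complex
  is the cone of multiplication by \<open>x\<close>.\<close>

lemma koszul_koszul:
  assumes "set xs \<subseteq> carrier R" "\<And>s. c s \<in> carrier M"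
  shows "koszul M xs (koszul M xs c) s = \<zero>\<^bsub>M\<^esub>"
  using assms
proof (induction xs arbitrary: c s)
  case Nil
  then show ?case by simp
next
  case (Cons x xs)
  show ?case
  proof (cases s)
    case Nil
    with Cons.prems show ?thesis by simp
  next
    case (Cons a t)
    have cl: "koszul M xs (\<lambda>t. c (a # t)) t \<in> carrier M" for a t
      using Cons.prems by (auto intro!: koszul_closed)
    have IH: "koszul M xs (koszul M xs (\<lambda>t. c (a # t))) t = \<zero>\<^bsub>M\<^esub>" for a
      using Cons.prems by (intro Cons.IH) auto
    show ?thesis
    proof (cases a)
      case True
      have "koszul M xs (\<lambda>t. \<ominus>\<^bsub>M\<^esub> koszul M xs (\<lambda>t. c (True # t)) t) t = \<zero>\<^bsub>M\<^esub>"
        using cl Cons.prems IH[of True] by (subst koszul_uminus) auto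
      then show ?thesis using Cons True by simp
    next
      case False
      have "koszul M xs (\<lambda>t. koszul M xs (\<lambda>t. c (False # t)) t \<oplus>\<^bsub>M\<^esub> x \<odot>\<^bsub>M\<^esub> c (True # t)) t
          = koszul M xs (koszul M xs (\<lambda>t. c (False # t))) t
            \<oplus>\<^bsub>M\<^esub> koszul M xs (\<lambda>t. x \<odot>\<^bsub>M\<^esub> c (True # t)) t"
        using cl Cons.prems by (intro koszul_add) auto
      also have "\<dots> = x \<odot>\<^bsub>M\<^esub> koszul M xs (\<lambda>t. c (True # t)) t"
        using cl Cons.prems IH[of False] by (simp add: koszul_smult)
      finally show ?thesis
        using Cons False Cons.prems cl by (simp add: smult_r_minus M.r_neg)
    qed
  qed
qed

lemma koszul_chainD:
  "c \<in> koszul_chain M n i \<Longrightarrow> c s \<in> carrier M"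
  "c \<in> koszul_chain M n i \<Longrightarrow> length s \<noteq> n \<or> int (count_list s True) \<noteq> i \<Longrightarrow> c s = \<zero>\<^bsub>M\<^esub>"
  by (auto simp: koszul_chain_def)

lemma koszul_chain_zero: "(\<lambda>s. \<zero>\<^bsub>M\<^esub>) \<in> koszul_chain M n i"
  by (simp add: koszul_chain_def)

lemma koszul_chain_add:
  "b \<in> koszul_chain M n i \<Longrightarrow> c \<in> koszul_chain M n i \<Longrightarrow>
    (\<lambda>s. b s \<oplus>\<^bsub>M\<^esub> c s) \<in> koszul_chain M n i"
  by (auto simp: koszul_chain_def) (metis M.r_zero M.zero_closed)+

lemma koszul_chain_smult:
  "r \<in> carrier R \<Longrightarrow> c \<in> koszul_chain M n i \<Longrightarrow> (\<lambda>s. r \<odot>\<^bsub>M\<^esub> c s) \<in> koszul_chain M n i"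
  by (auto simp: koszul_chain_def) (metis smult_r_null)+

lemma koszul_chain_uminus:
  "c \<in> koszul_chain M n i \<Longrightarrow> (\<lambda>s. \<ominus>\<^bsub>M\<^esub> c s) \<in> koszul_chain M n i"
  by (auto simp: koszul_chain_def)

lemma koszul_chain_tail:
  "c \<in> koszul_chain M (Suc n) i \<Longrightarrow>
    (\<lambda>t. c (a # t)) \<in> koszul_chain M n (if a then i - 1 else i)"
  by (cases a) (force simp: koszul_chain_def)+

lemma koszul_chain_koszul:
  assumes "set xs \<subseteq> carrier R" "c \<in> koszul_chain M (length xs) i"
  shows "koszul M xs c \<in> koszul_chain M (length xs) (i - 1)"
  using assms
proof (induction xs arbitrary: c i)
  case Nil
  then show ?case by (simp add: koszul_chain_def)
next
  case (Cons x xs)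
  have F: "koszul M xs (\<lambda>t. c (False # t)) \<in> koszul_chain M (length xs) (i - 1)"
    using Cons.prems koszul_chain_tail[of c "length xs" i False] by (intro Cons.IH) auto
  have T: "koszul M xs (\<lambda>t. c (True # t)) \<in> koszul_chain M (length xs) (i - 1 - 1)"
    using Cons.prems koszul_chain_tail[of c "length xs" i True] by (intro Cons.IH) auto
  have "koszul M (x # xs) c s \<in> carrier M" for s
    using Cons.prems by (intro koszul_closed) (auto simp: koszul_chain_def)
  moreover have "koszul M (x # xs) c s = \<zero>\<^bsub>M\<^esub>"
    if "\<not> (length s = length (x # xs) \<and> int (count_list s True) = i - 1)" for s
  proof (cases s)
    case Nil
    then show ?thesis by simp
  next
    case (Cons a t)
    then show ?thesis
      using koszul_chainD(2)[OF F, of t] koszul_chainD(2)[OF T, of t]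
        koszul_chainD(2)[OF Cons.prems(2), of "True # t"] that Cons.prems
      by (cases a) auto
  qed
  ultimately show ?case
    unfolding koszul_chain_def by blast
qed

lemma koszul_chain_neg: "c \<in> koszul_chain M n i \<Longrightarrow> i < 0 \<Longrightarrow> c s = \<zero>\<^bsub>M\<^esub>"
  by (rule koszul_chainD(2)) auto

lemma koszul_chain_top: "c \<in> koszul_chain M n i \<Longrightarrow> int n < i \<Longrightarrow> c s = \<zero>\<^bsub>M\<^esub>"
  using count_le_length[of s True] by (intro koszul_chainD(2)[of c n i]) auto

lemma koszul_bottom:
  "set xs \<subseteq> carrier R \<Longrightarrow> c \<in> koszul_chain M (length xs) 0 \<Longrightarrow> koszul M xs c s = \<zero>\<^bsub>M\<^esub>"
  using koszul_chain_koszul[of xs c 0] koszul_chain_neg by auto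

definition koszul_join :: "(bool list \<Rightarrow> 'c) \<Rightarrow> (bool list \<Rightarrow> 'c) \<Rightarrow> bool list \<Rightarrow> 'c" where
  "koszul_join b d s = (case s of [] \<Rightarrow> \<zero>\<^bsub>M\<^esub> | a # t \<Rightarrow> if a then d t else b t)"

lemma koszul_join_simps [simp]:
  "koszul_join b d [] = \<zero>\<^bsub>M\<^esub>"
  "koszul_join b d (True # t) = d t"
  "koszul_join b d (False # t) = b t"
  by (simp_all add: koszul_join_def)

lemma koszul_chain_join:
  "b \<in> koszul_chain M n i \<Longrightarrow> d \<in> koszul_chain M n (i - 1) \<Longrightarrow>
    koszul_join b d \<in> koszul_chain M (Suc n) i"
  by (auto simp: koszul_chain_def koszul_join_def split: list.splits)

text \<open>The long exact sequence of the cone, done by hand. For a cycle with parts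
  \<open>F\<close> and \<open>T\<close>, \<open>T\<close> is a cycle one degree lower, hence a
  boundary \<open>d b'\<close>. Then \<open>F + x b'\<close> is a cycle, equal to some
  \<open>d b\<close>, and \<open>(b, - b')\<close> bounds \<open>(F, T)\<close>: the sign cancels
  the one in the differential.\<close>

lemma koszul_exact:
  assumes "set xs \<subseteq> carrier R" "koszul_regular M xs" "i > 0"
    and "c \<in> koszul_chain M (length xs) i" "\<And>s. koszul M xs c s = \<zero>\<^bsub>M\<^esub>"
  shows "\<exists>b\<in>koszul_chain M (length xs) (i + 1). \<forall>s. c s = koszul M xs b s"
  using assms
proof (induction xs arbitrary: c i)
  case Nil
  then have "c s = koszul M [] (\<lambda>s. \<zero>\<^bsub>M\<^esub>) s" for s
    using koszul_chain_top[of c 0 i] by simp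
  then show ?case using koszul_chain_zero by blast
next
  case (Cons x xs)
  let ?n = "length xs"
  let ?F = "\<lambda>t. c (False # t)" and ?T = "\<lambda>t. c (True # t)"
  note xs = Cons.prems(1)
  have x: "x \<in> carrier R" and xs': "set xs \<subseteq> carrier R" using xs by auto
  have F: "?F \<in> koszul_chain M ?n i" and T: "?T \<in> koszul_chain M ?n (i - 1)"
    using Cons.prems(4) koszul_chain_tail[of c ?n i False] koszul_chain_tail[of c ?n i True]
    by simp_all
  have cF: "koszul M xs ?F s \<in> carrier M" for s
    by (rule koszul_closed[OF xs']) (rule koszul_chainD(1)[OF F])
  have cT: "koszul M xs ?T s \<in> carrier M" for s
    by (rule koszul_closed[OF xs']) (rule koszul_chainD(1)[OF T])
  have dF: "koszul M xs ?F s \<oplus>\<^bsub>M\<^esub> x \<odot>\<^bsub>M\<^esub> ?T s = \<zero>\<^bsub>M\<^esub>" for s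
    using Cons.prems(5)[of "False # s"] by simp
  have dT: "koszul M xs ?T s = \<zero>\<^bsub>M\<^esub>" for s
    using Cons.prems(5)[of "True # s"] cT[of s] by simp
  have "\<exists>b\<in>koszul_chain M ?n i. \<forall>s. ?T s = koszul M xs b s"
  proof (cases "i = 1")
    \<comment> \<open>Here \<open>?T\<close> has degree 0, out of reach of the induction hypothesis.
      Since \<open>x ?T\<close> is the boundary of \<open>- ?F\<close>, regularity takes its
      place.\<close>
    case True
    have "x \<odot>\<^bsub>M\<^esub> ?T s = koszul M xs (\<lambda>s. \<ominus>\<^bsub>M\<^esub> ?F s) s" for s
    proof -
      have xT: "x \<odot>\<^bsub>M\<^esub> ?T s \<in> carrier M"
        using x koszul_chainD(1)[OF T, of s] by simp
      have "\<ominus>\<^bsub>M\<^esub> koszul M xs ?F s = x \<odot>\<^bsub>M\<^esub> ?T s"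
        using dF[of s] M.a_comm[OF cF[of s] xT] cF[of s] xT by (intro M.minus_equality) simp_all
      then show ?thesis
        using koszul_uminus[OF xs', of ?F s] koszul_chainD(1)[OF F] by simp
    qed
    moreover have "(\<lambda>s. \<ominus>\<^bsub>M\<^esub> ?F s) \<in> koszul_chain M ?n 1"
      using koszul_chain_uminus[OF F] True by simp
    ultimately show ?thesis
      using Cons.prems(2) T True by (auto simp del: koszul_regular.simps simp add: koszul_regular.simps(2))
  next
    case False
    with Cons.IH[OF xs' _ _ T dT] Cons.prems(2,3) show ?thesis by simp
  qed
  then obtain b' where b': "b' \<in> koszul_chain M ?n i" "\<And>s. ?T s = koszul M xs b' s"
    by blast
  define e where "e = (\<lambda>s. ?F s \<oplus>\<^bsub>M\<^esub> x \<odot>\<^bsub>M\<^esub> b' s)"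
  have e: "e \<in> koszul_chain M ?n i"
    unfolding e_def using F b' x by (intro koszul_chain_add koszul_chain_smult)
  have "koszul M xs e s = \<zero>\<^bsub>M\<^esub>" for s
  proof -
    have "koszul M xs e s = koszul M xs ?F s \<oplus>\<^bsub>M\<^esub> x \<odot>\<^bsub>M\<^esub> koszul M xs b' s"
      unfolding e_def using koszul_chainD(1)[OF F] koszul_chainD(1)[OF b'(1)] x xs'
      by (subst koszul_add) (auto simp: koszul_smult)
    then show ?thesis using dF[of s] b'(2)[of s] by simp
  qed
  from Cons.IH[OF xs' _ _ e this] Cons.prems(2,3) obtain b
    where b: "b \<in> koszul_chain M ?n (i + 1)" "\<And>s. e s = koszul M xs b s"
    by auto
  let ?j = "koszul_join b (\<lambda>s. \<ominus>\<^bsub>M\<^esub> b' s)"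
  have "?j \<in> koszul_chain M (Suc ?n) (i + 1)"
    using b b' by (intro koszul_chain_join koszul_chain_uminus) auto
  moreover have "c s = koszul M (x # xs) ?j s" for s
  proof (cases s)
    case Nil
    then show ?thesis using Cons.prems(4) koszul_chainD(2)[of c "length (x # xs)" i "[]"] by simp
  next
    case (Cons a t)
    have *: "koszul M xs (\<lambda>s. \<ominus>\<^bsub>M\<^esub> b' s) t = \<ominus>\<^bsub>M\<^esub> ?T t"
      using b'(2)[of t] koszul_chainD(1)[OF b'(1)] xs' by (simp add: koszul_uminus)
    show ?thesis
    proof (cases a)
      case True
      then show ?thesis using Cons * koszul_chainD(1)[OF T, of t] by simp
    next
      case False
      have "koszul M xs b t = ?F t \<oplus>\<^bsub>M\<^esub> x \<odot>\<^bsub>M\<^esub> b' t" using b(2)[of t] by (simp add: e_def)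
      then show ?thesis
        using Cons False koszul_chainD(1)[OF F, of t] koszul_chainD(1)[OF b'(1), of t] x
        by (simp add: smult_r_minus M.a_assoc M.r_neg)
    qed
  qed
  ultimately show ?case by auto
qed

end

section \<open>Module homomorphisms and naturality of the Koszul complex\<close>

lemma module_hom_closed: "f \<in> module_hom R M N \<Longrightarrow> x \<in> carrier M \<Longrightarrow> f x \<in> carrier N"
  by (auto simp: module_hom_def)

lemma module_hom_add: "f \<in> module_hom R M N \<Longrightarrow> x \<in> carrier M \<Longrightarrow> y \<in> carrier M \<Longrightarrow>
    f (x \<oplus>\<^bsub>M\<^esub> y) = f x \<oplus>\<^bsub>N\<^esub> f y"
  by (auto simp: module_hom_def)

lemma module_hom_smult: "f \<in> module_hom R M N \<Longrightarrow> a \<in> carrier R \<Longrightarrow> x \<in> carrier M \<Longrightarrow>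
    f (a \<odot>\<^bsub>M\<^esub> x) = a \<odot>\<^bsub>N\<^esub> f x"
  by (auto simp: module_hom_def)

lemma module_hom_zero:
  assumes "module R M" "module R N" "f \<in> module_hom R M N"
  shows "f \<zero>\<^bsub>M\<^esub> = \<zero>\<^bsub>N\<^esub>"
proof -
  interpret M: module R M by fact
  interpret N: module R N by fact
  have "f (\<zero>\<^bsub>R\<^esub> \<odot>\<^bsub>M\<^esub> \<zero>\<^bsub>M\<^esub>) = \<zero>\<^bsub>R\<^esub> \<odot>\<^bsub>N\<^esub> f \<zero>\<^bsub>M\<^esub>"
    by (rule module_hom_smult[OF assms(3)]) auto
  then show ?thesis using module_hom_closed[OF assms(3), of "\<zero>\<^bsub>M\<^esub>"] by simp
qed

lemma module_hom_uminus:
  assumes "module R M" "module R N" "f \<in> module_hom R M N" "x \<in> carrier M"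
  shows "f (\<ominus>\<^bsub>M\<^esub> x) = \<ominus>\<^bsub>N\<^esub> f x"
proof -
  interpret M: module R M by fact
  interpret N: module R N by fact
  have "f ((\<ominus>\<^bsub>R\<^esub> \<one>\<^bsub>R\<^esub>) \<odot>\<^bsub>M\<^esub> x) = (\<ominus>\<^bsub>R\<^esub> \<one>\<^bsub>R\<^esub>) \<odot>\<^bsub>N\<^esub> f x"
    by (rule module_hom_smult[OF assms(3)]) (use assms in auto)
  then show ?thesis using module_hom_closed[OF assms(3), of x] assms(4)
    by (simp add: M.smult_l_minus N.smult_l_minus)
qed

lemma koszul_natural:
  assumes "module R M" "module R N" "f \<in> module_hom R M N"
    and "set xs \<subseteq> carrier R" "\<And>s. c s \<in> carrier M"
  shows "f (koszul M xs c s) = koszul N xs (\<lambda>s. f (c s)) s"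
  using assms(4,5)
proof (induction xs arbitrary: c s)
  case Nil
  then show ?case by (simp add: module_hom_zero[OF assms(1-3)])
next
  case (Cons x xs)
  interpret M: module R M by fact
  show ?case
  proof (cases s)
    case Nil
    then show ?thesis by (simp add: module_hom_zero[OF assms(1-3)])
  next
    case (Cons a t)
    have "f (koszul M xs (\<lambda>t. c (a # t)) t) = koszul N xs (\<lambda>t. f (c (a # t))) t"
      using Cons.prems by (intro Cons.IH) auto
    moreover have "koszul M xs (\<lambda>t. c (a # t)) t \<in> carrier M"
      using Cons.prems by (intro M.koszul_closed) auto
    ultimately show ?thesis
      using Cons Cons.prems
      by (cases a) (simp_all add: module_hom_uminus[OF assms(1-3)] module_hom_add[OF assms(3)]
          module_hom_smult[OF assms(3)])
  qed
qed

lemma koszul_chain_hom: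
  assumes "module R M" "module R N" "f \<in> module_hom R M N" "c \<in> koszul_chain M n i"
  shows "(\<lambda>s. f (c s)) \<in> koszul_chain N n i"
  using assms(4) module_hom_zero[OF assms(1-3)] module_hom_closed[OF assms(3)]
  by (auto simp: koszul_chain_def) metis+

text \<open>Degree 0 is left out: the homology there is \<open>M\<close> modulo
  \<open>(xs) M\<close>, in general nonzero.\<close>

definition koszul_acyclic :: "('r, 's) ring_scheme \<Rightarrow> ('r, 'm, 'x) module_scheme \<Rightarrow> 'r list \<Rightarrow> bool" where
  "koszul_acyclic R M xs \<longleftrightarrow>
    (\<forall>i>0. \<forall>c\<in>koszul_chain M (length xs) i. (\<forall>s. koszul M xs c s = \<zero>\<^bsub>M\<^esub>) \<longrightarrow>
       (\<exists>b\<in>koszul_chain M (length xs) (i + 1). \<forall>s. c s = koszul M xs b s))"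

lemma koszul_acyclicD:
  assumes "koszul_acyclic R M xs" "i > 0" "c \<in> koszul_chain M (length xs) i"
    and "\<And>s. koszul M xs c s = \<zero>\<^bsub>M\<^esub>"
  shows "\<exists>b\<in>koszul_chain M (length xs) (i + 1). \<forall>s. c s = koszul M xs b s"
  using assms unfolding koszul_acyclic_def by simp

text \<open>A cycle is carried by \<open>h\<close> into \<open>N\<close>, where it bounds;
  \<open>g\<close> carries the bounding chain back, and \<open>g\<close> after \<open>h\<close> is
  the identity.\<close>

lemma koszul_acyclic_retract:
  assumes M: "module R M" and N: "module R N" and h: "h \<in> module_hom R M N"
    and g: "g \<in> module_hom R N M" and gh: "\<And>x. x \<in> carrier M \<Longrightarrow> g (h x) = x"
    and xs: "set xs \<subseteq> carrier R" and acyclic: "koszul_acyclic R N xs"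
  shows "koszul_acyclic R M xs"
  unfolding koszul_acyclic_def
proof (intro allI impI ballI)
  fix i :: int and c
  assume i: "0 < i" and c: "c \<in> koszul_chain M (length xs) i"
    and z: "\<forall>s. koszul M xs c s = \<zero>\<^bsub>M\<^esub>"
  interpret M: module R M by fact
  interpret N: module R N by fact
  have "koszul N xs (\<lambda>s. h (c s)) s = \<zero>\<^bsub>N\<^esub>" for s
    using koszul_natural[OF M N h xs, of c s] M.koszul_chainD(1)[OF c] z
      module_hom_zero[OF M N h] by simp
  with acyclic i koszul_chain_hom[OF M N h c] obtain b
    where b: "b \<in> koszul_chain N (length xs) (i + 1)" "\<And>s. h (c s) = koszul N xs b s"
    unfolding koszul_acyclic_def by blast
  have "c s = koszul M xs (\<lambda>s. g (b s)) s" for s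
    using koszul_natural[OF N M g xs, of b s] b(2)[of s] gh M.koszul_chainD(1)[OF c]
      N.koszul_chainD(1)[OF b(1)] by metis
  then show "\<exists>b\<in>koszul_chain M (length xs) (i + 1). \<forall>s. c s = koszul M xs b s"
    using koszul_chain_hom[OF N M g b(1)] by blast
qed

lemma koszul_chain_lift:
  assumes "module R N" "\<And>s. c s \<in> f ` carrier M" "c \<in> koszul_chain N n i" "module R M"
    "f \<in> module_hom R M N"
  shows "\<exists>b\<in>koszul_chain M n i. \<forall>s. c s = f (b s)"
proof -
  interpret M: module R M by fact
  obtain b where b: "\<And>s. b s \<in> carrier M" "\<And>s. c s = f (b s)"
    using assms(2) unfolding image_iff by metis
  \<comment> \<open>The preimage of zero must be chosen zero, or the lift could have support outside
    degree \<open>i\<close>.\<close>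
  define b' where "b' = (\<lambda>s. if c s = \<zero>\<^bsub>N\<^esub> then \<zero>\<^bsub>M\<^esub> else b s)"
  have "b' \<in> koszul_chain M n i"
    using b(1) assms(3) by (auto simp: koszul_chain_def b'_def)
  moreover have "\<forall>s. c s = f (b' s)"
    using b(2) module_hom_zero[OF assms(4,1,5)] by (simp add: b'_def)
  ultimately show ?thesis by blast
qed

section \<open>Koszul cycles along a projective resolution\<close>

text \<open>The boundary of \<open>c\<close> lifts along \<open>D j\<close> to \<open>c'\<close>, in
  degree \<open>i - 1\<close> over \<open>P (Suc j)\<close>, and the boundary of \<open>c'\<close>
  lifts again because \<open>D j\<close> kills it. Induction applies to \<open>c'\<close> since
  \<open>i + j\<close> is unchanged, and it ends beyond \<open>d\<close>, where everything is
  zero.\<close>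

lemma resolution_ladder:
  assumes res: "\<And>i. module R (P i)" "\<And>i. D i \<in> module_hom R (P (Suc i)) (P i)"
    "\<And>i. D (Suc i) ` carrier (P (Suc (Suc i))) = a_kernel (P (Suc i)) (P i) (D i)"
    and xs: "set xs \<subseteq> carrier R" and acyclic: "\<And>i. koszul_acyclic R (P i) xs"
    and zero: "\<And>i. i > d \<Longrightarrow> carrier (P i) = {\<zero>\<^bsub>P i\<^esub>}"
    and i: "i + int j > int d"
    and c: "c \<in> koszul_chain (P j) (length xs) i"
    and kc: "\<And>s. koszul (P j) xs c s \<in> D j ` carrier (P (Suc j))"
  shows "\<exists>b\<in>koszul_chain (P j) (length xs) (i + 1). \<exists>e\<in>koszul_chain (P (Suc j)) (length xs) i.
    \<forall>s. c s = koszul (P j) xs b s \<oplus>\<^bsub>P j\<^esub> D j (e s)"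
  using i c kc
proof (induction "Suc d - j" arbitrary: j i c)
  case 0
  interpret P: module R "P j" by (rule res)
  interpret Q: module R "P (Suc j)" by (rule res)
  have "carrier (P j) = {\<zero>\<^bsub>P j\<^esub>}" using zero[of j] 0 by simp
  then have "c s = \<zero>\<^bsub>P j\<^esub>" for s using P.koszul_chainD(1)[OF 0(3), of s] by simp
  moreover have "koszul (P j) xs (\<lambda>s. \<zero>\<^bsub>P j\<^esub>) s \<oplus>\<^bsub>P j\<^esub> D j \<zero>\<^bsub>P (Suc j)\<^esub> = \<zero>\<^bsub>P j\<^esub>" for s
    using module_hom_zero[OF res(1) res(1) res(2), of j] xs by (simp add: P.koszul_zero)
  ultimately show ?case
    by (intro bexI[OF _ P.koszul_chain_zero] bexI[OF _ Q.koszul_chain_zero]) simp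
next
  case (Suc k)
  let ?n = "length xs"
  interpret P: module R "P j" by (rule res)
  interpret Q: module R "P (Suc j)" by (rule res)
  note D = res(2)[of j]
  \<comment> \<open>Here \<open>j\<close> is at most \<open>d\<close>, so the total degree leaves
    \<open>i\<close> positive, as the acyclicity of \<open>P j\<close> requires.\<close>
  have i: "i > 0" using Suc(2,3) by linarith
  note kc = P.koszul_chain_koszul[OF xs Suc.prems(2)]
  from koszul_chain_lift[OF res(1) Suc.prems(3) kc res(1) res(2)] obtain c'
    where c': "c' \<in> koszul_chain (P (Suc j)) ?n (i - 1)" "\<And>s. koszul (P j) xs c s = D j (c' s)"
    by blast
  have "D j (koszul (P (Suc j)) xs c' s) = \<zero>\<^bsub>P j\<^esub>" for s
  proof -
    have "D j (koszul (P (Suc j)) xs c' s) = koszul (P j) xs (\<lambda>s. D j (c' s)) s"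
      using Q.koszul_chainD(1)[OF c'(1)] by (intro koszul_natural[OF res(1) res(1) D xs])
    also have "\<dots> = koszul (P j) xs (koszul (P j) xs c) s"
      using c'(2)[symmetric] by (simp only:)
    also have "\<dots> = \<zero>\<^bsub>P j\<^esub>"
      using P.koszul_chainD(1)[OF Suc.prems(2)] by (intro P.koszul_koszul xs)
    finally show ?thesis .
  qed
  then have "koszul (P (Suc j)) xs c' s \<in> D (Suc j) ` carrier (P (Suc (Suc j)))" for s
    unfolding res(3) a_kernel_def' using Q.koszul_closed[OF xs] Q.koszul_chainD(1)[OF c'(1)] by simp
  moreover have "int d < (i - 1) + int (Suc j)" "k = Suc d - Suc j" using Suc by simp_all
  ultimately obtain b' e' where b': "b' \<in> koszul_chain (P (Suc j)) ?n i"
    and e': "e' \<in> koszul_chain (P (Suc (Suc j))) ?n (i - 1)"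
    and be: "\<And>s. c' s = koszul (P (Suc j)) xs b' s \<oplus>\<^bsub>P (Suc j)\<^esub> D (Suc j) (e' s)"
    using Suc.hyps(1)[of "Suc j" "i - 1" c'] c'(1) by auto
  interpret Q': module R "P (Suc (Suc j))" by (rule res)
  have DD: "D j (D (Suc j) x) = \<zero>\<^bsub>P j\<^esub>" if "x \<in> carrier (P (Suc (Suc j)))" for x
    using res(3)[of j] that unfolding a_kernel_def' by blast
  have b'c: "b' s \<in> carrier (P (Suc j))" for s by (rule Q.koszul_chainD(1)[OF b'])
  have Db: "(\<lambda>s. D j (b' s)) \<in> koszul_chain (P j) ?n i"
    by (rule koszul_chain_hom[OF res(1) res(1) D b'])
  \<comment> \<open>The \<open>e'\<close> part of \<open>c'\<close> dies under \<open>D j\<close>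
    after \<open>D (Suc j)\<close>, so \<open>c\<close> and the image of \<open>b'\<close> have the
    same boundary; their difference \<open>f\<close> is a cycle and therefore bounds.\<close>
  have kcD: "koszul (P j) xs c s = koszul (P j) xs (\<lambda>s. D j (b' s)) s" for s
  proof -
    have "koszul (P (Suc j)) xs b' s \<in> carrier (P (Suc j))" by (rule Q.koszul_closed[OF xs b'c])
    moreover have "e' s \<in> carrier (P (Suc (Suc j)))" by (rule Q'.koszul_chainD(1)[OF e'])
    moreover have "D (Suc j) (e' s) \<in> carrier (P (Suc j))"
      by (rule module_hom_closed[OF res(2)]) fact
    moreover have "koszul (P j) xs (\<lambda>s. D j (b' s)) s \<in> carrier (P j)"
      by (rule P.koszul_closed[OF xs]) (rule P.koszul_chainD(1)[OF Db])
    ultimately show ?thesis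
      using c'(2)[of s] be[of s] DD koszul_natural[OF res(1) res(1) D xs, of b' s] b'c
      by (simp add: module_hom_add[OF D])
  qed
  define f where "f = (\<lambda>s. c s \<oplus>\<^bsub>P j\<^esub> (\<ominus>\<^bsub>P j\<^esub> D j (b' s)))"
  have f: "f \<in> koszul_chain (P j) ?n i"
    unfolding f_def by (intro P.koszul_chain_add P.koszul_chain_uminus Suc.prems Db)
  have kf: "koszul (P j) xs f s = \<zero>\<^bsub>P j\<^esub>" for s
  proof -
    have cl: "c s \<in> carrier (P j)" "D j (b' s) \<in> carrier (P j)" for s
      by (rule P.koszul_chainD(1)[OF Suc.prems(2)] P.koszul_chainD(1)[OF Db])+
    have "koszul (P j) xs f s = koszul (P j) xs c s \<oplus>\<^bsub>P j\<^esub>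
        koszul (P j) xs (\<lambda>s. \<ominus>\<^bsub>P j\<^esub> D j (b' s)) s"
      unfolding f_def using cl by (intro P.koszul_add xs) auto
    also have "koszul (P j) xs (\<lambda>s. \<ominus>\<^bsub>P j\<^esub> D j (b' s)) s =
        \<ominus>\<^bsub>P j\<^esub> koszul (P j) xs (\<lambda>s. D j (b' s)) s"
      using cl by (intro P.koszul_uminus xs) auto
    finally show ?thesis
      unfolding kcD using P.koszul_closed[OF xs, of "\<lambda>s. D j (b' s)" s] cl by (simp add: P.r_neg)
  qed
  from koszul_acyclicD[OF acyclic i f kf] obtain b where b: "b \<in> koszul_chain (P j) ?n (i + 1)"
    "\<And>s. f s = koszul (P j) xs b s"
    by auto
  have cb: "c s = koszul (P j) xs b s \<oplus>\<^bsub>P j\<^esub> D j (b' s)" for s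
    unfolding b(2)[of s, symmetric] f_def
    using P.koszul_chainD(1)[OF Suc.prems(2), of s] P.koszul_chainD(1)[OF Db, of s]
    by (simp add: P.a_assoc P.l_neg)
  show ?case
  proof (rule bexI[OF _ b(1)], rule bexI[OF _ b'], rule allI)
    show "c s = koszul (P j) xs b s \<oplus>\<^bsub>P j\<^esub> D j (b' s)" for s
      by (rule cb)
  qed
qed

text \<open>The socle element is placed in the single slot of top degree, a cycle because every
  element of \<open>xs\<close> kills \<open>z\<close>. Its lift to \<open>P 0\<close> has boundary
  in the kernel of \<open>\<epsilon>\<close>, so the ladder applies with
  \<open>j = 0\<close>.\<close>

theorem projective_length_ge:
  assumes M: "module R M" and res: "projective_resolution R M P D \<epsilon>"
    and xs: "set xs \<subseteq> carrier R" and acyclic: "\<And>i. koszul_acyclic R (P i) xs"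
    and zero: "\<And>i. i > d \<Longrightarrow> carrier (P i) = {\<zero>\<^bsub>P i\<^esub>}"
    and z: "z \<in> carrier M" "z \<noteq> \<zero>\<^bsub>M\<^esub>" "\<And>x. x \<in> set xs \<Longrightarrow> x \<odot>\<^bsub>M\<^esub> z = \<zero>\<^bsub>M\<^esub>"
  shows "length xs \<le> d"
proof (rule ccontr)
  assume d: "\<not> length xs \<le> d"
  let ?n = "length xs"
  have Pm: "module R (P i)" and D: "D i \<in> module_hom R (P (Suc i)) (P i)"
    and ex: "D (Suc i) ` carrier (P (Suc (Suc i))) = a_kernel (P (Suc i)) (P i) (D i)"
    and e: "\<epsilon> \<in> module_hom R (P 0) M" "\<epsilon> ` carrier (P 0) = carrier M"
    and e0: "D 0 ` carrier (P 1) = a_kernel (P 0) M \<epsilon>" for i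
    using res unfolding projective_resolution_def projective_module_def by simp_all
  interpret M: module R M by fact
  interpret P: module R "P 0" by (rule Pm)
  interpret Q: module R "P (Suc 0)" by (rule Pm)
  define t where "t = replicate ?n True"
  define zc where "zc = (\<lambda>s. if s = t then z else \<zero>\<^bsub>M\<^esub>)"
  have "count_list (replicate m True) True = m" for m
    by (induction m) auto
  then have zc: "zc \<in> koszul_chain M ?n (int ?n)"
    using z(1) by (auto simp: zc_def t_def koszul_chain_def)
  have kz: "koszul M xs c s = \<zero>\<^bsub>M\<^esub>" if "set xs \<subseteq> carrier R" "\<And>s. c s \<in> carrier M"
    "\<And>x s. x \<in> set xs \<Longrightarrow> x \<odot>\<^bsub>M\<^esub> c s = \<zero>\<^bsub>M\<^esub>" for xs c s
    using that
  proof (induction xs arbitrary: c s)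
    case (Cons x xs)
    have "koszul M xs (\<lambda>t. c (a # t)) t = \<zero>\<^bsub>M\<^esub>" for a t
      using Cons.prems by (intro Cons.IH) auto
    then show ?case using Cons.prems by (cases s; cases "hd s") auto
  qed simp
  have kzc: "koszul M xs zc s = \<zero>\<^bsub>M\<^esub>" for s
    using z xs by (intro kz) (auto simp: zc_def)
  from koszul_chain_lift[OF M _ zc Pm e(1)] obtain c
    where c: "c \<in> koszul_chain (P 0) ?n (int ?n)" "\<And>s. zc s = \<epsilon> (c s)"
    unfolding e(2) using M.koszul_chainD(1)[OF zc] by auto
  have cc: "c s \<in> carrier (P 0)" for s by (rule P.koszul_chainD(1)[OF c(1)])
  have "koszul (P 0) xs c s \<in> D 0 ` carrier (P (Suc 0))" for s
    using e0 koszul_natural[OF Pm M e(1) xs, of c s] cc kzc[of s] P.koszul_closed[OF xs cc]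
    by (simp add: a_kernel_def' c(2)[symmetric])
  moreover have "int d < int ?n + int 0" using d by simp
  ultimately obtain b f where b: "b \<in> koszul_chain (P 0) ?n (int ?n + 1)"
    and f: "f \<in> koszul_chain (P (Suc 0)) ?n (int ?n)"
    and bf: "\<And>s. c s = koszul (P 0) xs b s \<oplus>\<^bsub>P 0\<^esub> D 0 (f s)"
    using resolution_ladder[where d = d, OF Pm D ex xs acyclic zero _ c(1)] by blast
  \<comment> \<open>No subset of the variables has \<open>?n + 1\<close> elements, so only the part
    coming from \<open>P 1\<close> is left, and \<open>\<epsilon>\<close> kills that.\<close>
  have "b = (\<lambda>s. \<zero>\<^bsub>P 0\<^esub>)" using P.koszul_chain_top[OF b] by auto
  then have "c t = D 0 (f t)"
    using bf[of t] module_hom_closed[OF D, of "f t" 0] Q.koszul_chainD(1)[OF f, of t] xs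
    by (simp add: P.koszul_zero)
  moreover have "D 0 (f t) \<in> a_kernel (P 0) M \<epsilon>"
    unfolding e0[symmetric] using Q.koszul_chainD(1)[OF f, of t] by simp
  ultimately show False
    using c(2)[of t] z(2) by (simp add: zc_def a_kernel_def')
qed

section \<open>Free and projective modules\<close>

text \<open>The multiplicative part of the record is junk: modules have none.\<close>

definition free_module :: "('r, 's) ring_scheme \<Rightarrow> 'p set \<Rightarrow> ('r, 'p \<Rightarrow> 'r) module" where
  "free_module R S =
    \<lparr>carrier = {\<phi>. finite {p. \<phi> p \<noteq> \<zero>\<^bsub>R\<^esub>} \<and> (\<forall>p. \<phi> p \<in> carrier R) \<and>
                    (\<forall>p. p \<notin> S \<longrightarrow> \<phi> p = \<zero>\<^bsub>R\<^esub>)},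
     mult = (\<lambda>\<phi> \<psi>. \<phi>), one = (\<lambda>p. \<zero>\<^bsub>R\<^esub>), zero = (\<lambda>p. \<zero>\<^bsub>R\<^esub>),
     add = (\<lambda>\<phi> \<psi> p. \<phi> p \<oplus>\<^bsub>R\<^esub> \<psi> p), smult = (\<lambda>a \<phi> p. a \<otimes>\<^bsub>R\<^esub> \<phi> p)\<rparr>"

lemma free_module_simps [simp]:
  "zero (free_module R S) = (\<lambda>p. \<zero>\<^bsub>R\<^esub>)"
  "add (free_module R S) \<phi> \<psi> = (\<lambda>p. \<phi> p \<oplus>\<^bsub>R\<^esub> \<psi> p)"
  "smult (free_module R S) a \<phi> = (\<lambda>p. a \<otimes>\<^bsub>R\<^esub> \<phi> p)"
  by (simp_all add: free_module_def)

lemma free_module_carrier: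
  "\<phi> \<in> carrier (free_module R S) \<longleftrightarrow> finite {p. \<phi> p \<noteq> \<zero>\<^bsub>R\<^esub>} \<and> (\<forall>p. \<phi> p \<in> carrier R) \<and>
     (\<forall>p. p \<notin> S \<longrightarrow> \<phi> p = \<zero>\<^bsub>R\<^esub>)"
  by (simp add: free_module_def)

lemma (in cring) free_module_map:
  assumes "\<phi> \<in> carrier (free_module R S)" "\<And>x. x \<in> carrier R \<Longrightarrow> f x \<in> carrier R" "f \<zero> = \<zero>"
  shows "(\<lambda>p. f (\<phi> p)) \<in> carrier (free_module R S)"
proof -
  have "{p. f (\<phi> p) \<noteq> \<zero>} \<subseteq> {p. \<phi> p \<noteq> \<zero>}" using assms(3) by auto
  then show ?thesis
    using assms finite_subset unfolding free_module_carrier by metis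
qed

lemma (in cring) free_module_add_closed:
  assumes "\<phi> \<in> carrier (free_module R S)" "\<psi> \<in> carrier (free_module R S)"
  shows "(\<lambda>p. \<phi> p \<oplus> \<psi> p) \<in> carrier (free_module R S)"
proof -
  have "{p. \<phi> p \<oplus> \<psi> p \<noteq> \<zero>} \<subseteq> {p. \<phi> p \<noteq> \<zero>} \<union> {p. \<psi> p \<noteq> \<zero>}" by auto
  then show ?thesis
    using assms finite_subset[of _ "{p. \<phi> p \<noteq> \<zero>} \<union> {p. \<psi> p \<noteq> \<zero>}"]
    unfolding free_module_carrier by simp
qed

lemma (in cring) free_module_is_module: "module R (free_module R S)"
proof (rule moduleI)
  show "cring R" ..
  show "abelian_group (free_module R S)"
  proof (rule abelian_groupI)
    fix \<phi> assume \<phi>: "\<phi> \<in> carrier (free_module R S)"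
    then have "(\<lambda>p. \<ominus> \<phi> p) \<in> carrier (free_module R S)"
      by (rule free_module_map) auto
    moreover have "(\<lambda>p. \<ominus> \<phi> p) \<oplus>\<^bsub>free_module R S\<^esub> \<phi> = \<zero>\<^bsub>free_module R S\<^esub>"
      using \<phi> by (auto simp: free_module_carrier l_neg)
    ultimately show "\<exists>\<psi>\<in>carrier (free_module R S). \<psi> \<oplus>\<^bsub>free_module R S\<^esub> \<phi> = \<zero>\<^bsub>free_module R S\<^esub>"
      by blast
  qed (auto simp: free_module_add_closed, auto simp: free_module_carrier a_ac)
  fix a \<phi> assume "a \<in> carrier R" "\<phi> \<in> carrier (free_module R S)"
  then show "a \<odot>\<^bsub>free_module R S\<^esub> \<phi> \<in> carrier (free_module R S)"
    by (auto intro: free_module_map)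
qed (auto simp: free_module_carrier l_distr r_distr m_assoc)

lemma (in cring) free_module_uminus:
  assumes "\<phi> \<in> carrier (free_module R S)"
  shows "\<ominus>\<^bsub>free_module R S\<^esub> \<phi> = (\<lambda>p. \<ominus> \<phi> p)"
proof -
  interpret F: module R "free_module R S" by (rule free_module_is_module)
  have "(\<lambda>p. \<ominus> \<phi> p) \<in> carrier (free_module R S)"
    using assms by (rule free_module_map) auto
  moreover have "(\<lambda>p. \<ominus> \<phi> p) \<oplus>\<^bsub>free_module R S\<^esub> \<phi> = \<zero>\<^bsub>free_module R S\<^esub>"
    using assms by (auto simp: free_module_carrier l_neg)
  ultimately show ?thesis using assms by (intro F.minus_equality)
qed

definition free_module_eval :: "('r, 's) ring_scheme \<Rightarrow> ('r, 'm, 'x) module_scheme \<Rightarrow> ('m \<Rightarrow> 'r) \<Rightarrow> 'm" where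
  "free_module_eval R M \<phi> = (\<Oplus>\<^bsub>M\<^esub> p\<in>{p. \<phi> p \<noteq> \<zero>\<^bsub>R\<^esub>}. \<phi> p \<odot>\<^bsub>M\<^esub> p)"

context module
begin

lemma free_module_eval_superset:
  assumes "\<phi> \<in> carrier (free_module R (carrier M))" "finite A" "{p. \<phi> p \<noteq> \<zero>} \<subseteq> A" "A \<subseteq> carrier M"
  shows "free_module_eval R M \<phi> = (\<Oplus>\<^bsub>M\<^esub> p\<in>A. \<phi> p \<odot>\<^bsub>M\<^esub> p)"
  unfolding free_module_eval_def
  using assms by (intro M.add.finprod_mono_neutral_cong_left) (auto simp: free_module_carrier)

lemma free_module_eval_hom:
  "free_module_eval R M \<in> module_hom R (free_module R (carrier M)) M"
  unfolding module_hom_def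
proof (intro CollectI conjI ballI funcsetI)
  let ?F = "free_module R (carrier M)"
  fix \<phi> assume \<phi>: "\<phi> \<in> carrier ?F"
  let ?A = "{p. \<phi> p \<noteq> \<zero>}"
  have A: "finite ?A" "?A \<subseteq> carrier M" "\<And>p. \<phi> p \<in> carrier R"
    using \<phi> by (auto simp: free_module_carrier)
  show "free_module_eval R M \<phi> \<in> carrier M"
    unfolding free_module_eval_def using A by (intro M.finsum_closed) auto
  fix \<psi> assume \<psi>: "\<psi> \<in> carrier ?F"
  let ?B = "{p. \<psi> p \<noteq> \<zero>}"
  have B: "finite ?B" "?B \<subseteq> carrier M" "\<And>p. \<psi> p \<in> carrier R"
    using \<psi> by (auto simp: free_module_carrier)
  have "free_module_eval R M (\<phi> \<oplus>\<^bsub>?F\<^esub> \<psi>) = (\<Oplus>\<^bsub>M\<^esub> p\<in>?A \<union> ?B. (\<phi> p \<oplus> \<psi> p) \<odot>\<^bsub>M\<^esub> p)"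
    using A B \<phi> \<psi> by (subst free_module_eval_superset[where A = "?A \<union> ?B"]) (auto intro: R.free_module_add_closed)
  also have "\<dots> = (\<Oplus>\<^bsub>M\<^esub> p\<in>?A \<union> ?B. \<phi> p \<odot>\<^bsub>M\<^esub> p \<oplus>\<^bsub>M\<^esub> \<psi> p \<odot>\<^bsub>M\<^esub> p)"
    using A B by (intro M.finsum_cong') (auto simp: smult_l_distr subset_iff)
  also have "\<dots> = (\<Oplus>\<^bsub>M\<^esub> p\<in>?A \<union> ?B. \<phi> p \<odot>\<^bsub>M\<^esub> p) \<oplus>\<^bsub>M\<^esub> (\<Oplus>\<^bsub>M\<^esub> p\<in>?A \<union> ?B. \<psi> p \<odot>\<^bsub>M\<^esub> p)"
    using A B by (intro M.finsum_addf) auto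
  also have "\<dots> = free_module_eval R M \<phi> \<oplus>\<^bsub>M\<^esub> free_module_eval R M \<psi>"
    using A B \<phi> \<psi> free_module_eval_superset[of \<phi> "?A \<union> ?B"] free_module_eval_superset[of \<psi> "?A \<union> ?B"]
    by simp
  finally show "free_module_eval R M (\<phi> \<oplus>\<^bsub>?F\<^esub> \<psi>) =
    free_module_eval R M \<phi> \<oplus>\<^bsub>M\<^esub> free_module_eval R M \<psi>" .
next
  let ?F = "free_module R (carrier M)"
  fix a \<phi> assume a: "a \<in> carrier R" and \<phi>: "\<phi> \<in> carrier ?F"
  let ?A = "{p. \<phi> p \<noteq> \<zero>}"
  have A: "finite ?A" "?A \<subseteq> carrier M" "\<And>p. \<phi> p \<in> carrier R"
    using \<phi> by (auto simp: free_module_carrier)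
  have "free_module_eval R M (a \<odot>\<^bsub>?F\<^esub> \<phi>) = (\<Oplus>\<^bsub>M\<^esub> p\<in>?A. (a \<otimes> \<phi> p) \<odot>\<^bsub>M\<^esub> p)"
    using A a \<phi> by (subst free_module_eval_superset[where A = "?A"]) (auto intro: R.free_module_map)
  also have "\<dots> = (\<Oplus>\<^bsub>M\<^esub> p\<in>?A. a \<odot>\<^bsub>M\<^esub> (\<phi> p \<odot>\<^bsub>M\<^esub> p))"
    using A a by (intro M.finsum_cong') (auto simp: smult_assoc1 subset_iff)
  also have "\<dots> = a \<odot>\<^bsub>M\<^esub> free_module_eval R M \<phi>"
    unfolding free_module_eval_def using A a by (subst finsum_smult_ldistr) auto
  finally show "free_module_eval R M (a \<odot>\<^bsub>?F\<^esub> \<phi>) = a \<odot>\<^bsub>M\<^esub> free_module_eval R M \<phi>" .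
qed

lemma free_module_eval_surj:
  "free_module_eval R M ` carrier (free_module R (carrier M)) = carrier M"
proof
  show "free_module_eval R M ` carrier (free_module R (carrier M)) \<subseteq> carrier M"
    using module_hom_closed[OF free_module_eval_hom] by blast
  show "carrier M \<subseteq> free_module_eval R M ` carrier (free_module R (carrier M))"
  proof
    fix x assume x: "x \<in> carrier M"
    let ?\<phi> = "\<lambda>p. if p = x then \<one> else \<zero>"
    have \<phi>: "?\<phi> \<in> carrier (free_module R (carrier M))"
      using x finite_subset[of "{p. ?\<phi> p \<noteq> \<zero>}" "{x}"] by (auto simp: free_module_carrier)
    have "free_module_eval R M ?\<phi> = (\<Oplus>\<^bsub>M\<^esub> p\<in>{x}. ?\<phi> p \<odot>\<^bsub>M\<^esub> p)"
      using \<phi> x by (intro free_module_eval_superset) auto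
    also have "\<dots> = x" using x by simp
    finally show "x \<in> free_module_eval R M ` carrier (free_module R (carrier M))"
      using \<phi> by (metis imageI)
  qed
qed

end

text \<open>A projective module is a retract of the free module on its underlying set.\<close>

lemma koszul_acyclic_projective:
  fixes P :: "('r, 'p) module" and R :: "('r, 's) ring_scheme"
  assumes "projective_module R P" "set xs \<subseteq> carrier R"
    and "koszul_acyclic R (free_module R (carrier P)) xs"
  shows "koszul_acyclic R P xs"
proof -
  interpret P: module R P using assms(1) by (simp add: projective_module_def)
  let ?F = "free_module R (carrier P)" and ?g = "free_module_eval R P"
  have P: "module R P" ..
  have F: "module R ?F" by (rule P.R.free_module_is_module)
  have "(\<lambda>x. x) \<in> module_hom R P P" by (auto simp: module_hom_def)
  \<comment> \<open>The identity of \<open>P\<close> is lifted along the evaluation; the free module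
    on \<open>carrier P\<close> has just the type over which \<open>projective_module\<close>
    quantifies.\<close>
  then obtain h where h: "h \<in> module_hom R P ?F" "\<And>x. x \<in> carrier P \<Longrightarrow> ?g (h x) = x"
    using assms(1) F P P.free_module_eval_hom P.free_module_eval_surj
    unfolding projective_module_def by blast
  show ?thesis
    by (rule koszul_acyclic_retract[OF P F h(1) P.free_module_eval_hom h(2) assms(2,3)])
qed

section \<open>Polynomial rings\<close>

lemma mpoly_ring_simps [simp]:
  "mult (mpoly_ring n) = (*)" "one (mpoly_ring n) = 1"
  "zero (mpoly_ring n) = 0" "add (mpoly_ring n) = (+)"
  by (simp_all add: mpoly_ring_def)

lemma mpoly_ring_carrier:
  "p \<in> carrier (mpoly_ring n) \<longleftrightarrow> (\<forall>m\<in>Poly_Mapping.keys p. Poly_Mapping.keys m \<subseteq> {..<n})"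
  by (simp add: mpoly_ring_def)

lemma mpoly_ring_add_closed:
  "p \<in> carrier (mpoly_ring n) \<Longrightarrow> q \<in> carrier (mpoly_ring n) \<Longrightarrow> p + q \<in> carrier (mpoly_ring n)"
  unfolding mpoly_ring_carrier using keys_add[of p q] by blast

lemma mpoly_ring_mult_closed:
  assumes "p \<in> carrier (mpoly_ring n)" "q \<in> carrier (mpoly_ring n)"
  shows "p * q \<in> carrier (mpoly_ring n)"
  unfolding mpoly_ring_carrier
proof
  fix m assume "m \<in> Poly_Mapping.keys (p * q)"
  then obtain a b where "m = a + b" "a \<in> Poly_Mapping.keys p" "b \<in> Poly_Mapping.keys q"
    using keys_mult[of p q] by blast
  then show "Poly_Mapping.keys m \<subseteq> {..<n}"
    using assms keys_add[of a b] unfolding mpoly_ring_carrier by blast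
qed

lemma mpoly_ring_uminus_closed:
  fixes p :: "'k::field mpol"
  shows "p \<in> carrier (mpoly_ring n) \<Longrightarrow> - p \<in> carrier (mpoly_ring n)"
  unfolding mpoly_ring_carrier by (simp add: in_keys_iff)

lemma mpoly_ring_cring: "cring (mpoly_ring n :: 'k::field mpol ring)"
proof (rule cringI)
  show "abelian_group (mpoly_ring n :: 'k mpol ring)"
  proof (rule abelian_groupI)
    fix x :: "'k mpol" assume "x \<in> carrier (mpoly_ring n)"
    then show "\<exists>y\<in>carrier (mpoly_ring n). y \<oplus>\<^bsub>mpoly_ring n\<^esub> x = \<zero>\<^bsub>mpoly_ring n\<^esub>"
      by (intro bexI[of _ "- x"] mpoly_ring_uminus_closed) simp_all
  qed (auto simp: mpoly_ring_add_closed algebra_simps, auto simp: mpoly_ring_carrier)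
  show "comm_monoid (mpoly_ring n :: 'k mpol ring)"
    by (rule comm_monoidI)
      (auto simp: mpoly_ring_mult_closed algebra_simps, auto simp: mpoly_ring_carrier)
qed (auto simp: algebra_simps)

lemma mpoly_ring_uminus:
  fixes p :: "'k::field mpol"
  assumes "p \<in> carrier (mpoly_ring n)"
  shows "\<ominus>\<^bsub>mpoly_ring n\<^esub> p = - p"
proof -
  interpret cring "mpoly_ring n :: 'k mpol ring" by (rule mpoly_ring_cring)
  show ?thesis using assms mpoly_ring_uminus_closed[OF assms] by (intro minus_equality) simp_all
qed

definition mvar :: "nat \<Rightarrow> 'k::field mpol" where
  "mvar i = Poly_Mapping.single (Poly_Mapping.single i 1) 1"

lemma mvar_closed: "i < n \<Longrightarrow> mvar i \<in> carrier (mpoly_ring n)"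
  by (simp add: mvar_def mpoly_ring_carrier)

lemma lookup_single_mult:
  fixes q :: "'k::field mpol"
  shows "Poly_Mapping.lookup (Poly_Mapping.single s c * q) (s + m) = c * Poly_Mapping.lookup q m"
proof -
  have "Poly_Mapping.lookup (Poly_Mapping.single s c * q) (s + m) =
      c * (\<Sum>r. Poly_Mapping.lookup q r when m = r)"
    by (simp add: lookup_mult lookup_single when_mult)
  then show ?thesis by simp
qed

lemma keys_single_mult:
  fixes q :: "'k::field mpol"
  shows "m \<in> Poly_Mapping.keys (Poly_Mapping.single s c * q) \<Longrightarrow> \<exists>t\<in>Poly_Mapping.keys q. m = s + t"
  using keys_mult[of "Poly_Mapping.single s c" q] by (auto split: if_splits)

text \<open>Reading coefficients at the shifted exponent discards the terms without variable
  \<open>i\<close>: this is the quotient of division by it.\<close>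

definition div_var :: "nat \<Rightarrow> 'k::field mpol \<Rightarrow> 'k mpol" where
  "div_var i = Poly_Mapping.map_key (\<lambda>m. Poly_Mapping.single i 1 + m)"

lemma lookup_div_var:
  "Poly_Mapping.lookup (div_var i p) m = Poly_Mapping.lookup p (Poly_Mapping.single i 1 + m)"
  unfolding div_var_def by (subst map_key.rep_eq) (auto simp: inj_on_def)

lemma div_var_0 [simp]: "div_var i 0 = 0"
  by (rule poly_mapping_eqI) (simp add: lookup_div_var)

lemma div_var_closed:
  assumes "p \<in> carrier (mpoly_ring n)"
  shows "div_var i p \<in> carrier (mpoly_ring n)"
  unfolding mpoly_ring_carrier
proof
  fix m assume "m \<in> Poly_Mapping.keys (div_var i p)"
  then have "Poly_Mapping.single i 1 + m \<in> Poly_Mapping.keys p"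
    by (simp add: in_keys_iff lookup_div_var)
  then have "Poly_Mapping.keys (Poly_Mapping.single i 1 + m) \<subseteq> {..<n}"
    using assms by (simp add: mpoly_ring_carrier)
  then show "Poly_Mapping.keys m \<subseteq> {..<n}"
    by (auto simp: in_keys_iff subset_iff lookup_add)
qed

text \<open>A monomial ideal contains a polynomial exactly if it contains each of its terms, so
  membership in the ideal of the variables in \<open>V\<close> becomes a condition on
  exponents.\<close>

definition in_var_ideal :: "nat set \<Rightarrow> 'k::field mpol \<Rightarrow> bool" where
  "in_var_ideal V p \<longleftrightarrow> (\<forall>m\<in>Poly_Mapping.keys p. Poly_Mapping.keys m \<inter> V \<noteq> {})"

lemma in_var_ideal_add: "in_var_ideal V p \<Longrightarrow> in_var_ideal V q \<Longrightarrow> in_var_ideal V (p + q)"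
  unfolding in_var_ideal_def using keys_add[of p q] by blast

lemma in_var_ideal_uminus: "in_var_ideal V p \<Longrightarrow> in_var_ideal V (- p)"
  unfolding in_var_ideal_def by (simp add: in_keys_iff)

lemma in_var_ideal_mvar_mult: "v \<in> V \<Longrightarrow> in_var_ideal V (mvar v * p)"
  unfolding in_var_ideal_def
proof
  fix m assume v: "v \<in> V" and "m \<in> Poly_Mapping.keys (mvar v * p)"
  then obtain t where "m = Poly_Mapping.single v 1 + t"
    unfolding mvar_def using keys_single_mult by blast
  then have "v \<in> Poly_Mapping.keys m" by (simp add: in_keys_iff lookup_add)
  with v show "Poly_Mapping.keys m \<inter> V \<noteq> {}" by blast
qed

text \<open>Multiplying by \<open>mvar v\<close> shifts exponents injectively and brings in no
  variable of \<open>V\<close>. A further variable is thus a nonzerodivisor modulo the ideal of the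
  others, which is the regularity of the sequence.\<close>

lemma in_var_ideal_cancel:
  assumes "in_var_ideal V (mvar v * p)" "v \<notin> V"
  shows "in_var_ideal V p"
  unfolding in_var_ideal_def
proof
  fix m assume "m \<in> Poly_Mapping.keys p"
  then have "Poly_Mapping.single v 1 + m \<in> Poly_Mapping.keys (mvar v * p)"
    by (simp add: mvar_def in_keys_iff lookup_single_mult)
  then obtain w where "w \<in> V" "w \<in> Poly_Mapping.keys (Poly_Mapping.single v 1 + m)"
    using assms(1) unfolding in_var_ideal_def by blast
  then show "Poly_Mapping.keys m \<inter> V \<noteq> {}"
    using assms(2) by (auto simp: in_keys_iff lookup_add lookup_single when_def split: if_splits)
qed

text \<open>The remainder keeps just the terms of \<open>p\<close> without \<open>v\<close>, and
  such a term must owe its membership to \<open>V\<close>.\<close>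

lemma in_var_ideal_remainder:
  assumes "in_var_ideal (insert v V) p"
  shows "in_var_ideal V (p - mvar v * div_var v p)"
  unfolding in_var_ideal_def
proof
  let ?s = "Poly_Mapping.single v (1::nat)"
  fix m assume m: "m \<in> Poly_Mapping.keys (p - mvar v * div_var v p)"
  have v: "v \<notin> Poly_Mapping.keys m"
  proof
    assume "v \<in> Poly_Mapping.keys m"
    then have "m = ?s + (m - ?s)"
      by (intro poly_mapping_eqI) (auto simp: lookup_add lookup_minus lookup_single when_def in_keys_iff)
    then obtain t where "m = ?s + t" by blast
    with m show False
      by (simp add: in_keys_iff lookup_minus mvar_def lookup_single_mult lookup_div_var)
  qed
  have "Poly_Mapping.lookup (mvar v * div_var v p) m = 0"
  proof (rule ccontr)
    assume "Poly_Mapping.lookup (mvar v * div_var v p) m \<noteq> 0"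
    then obtain t where "m = ?s + t"
      using keys_single_mult[of m ?s 1 "div_var v p"] by (auto simp: mvar_def in_keys_iff)
    with v show False by (simp add: in_keys_iff lookup_add)
  qed
  with m have "m \<in> Poly_Mapping.keys p" by (simp add: in_keys_iff lookup_minus)
  with assms v show "Poly_Mapping.keys m \<inter> V \<noteq> {}" unfolding in_var_ideal_def by auto
qed

section \<open>The variables as a regular sequence on free modules\<close>

abbreviation mpoly_free :: "nat \<Rightarrow> 'p set \<Rightarrow> ('k::field mpol, 'p \<Rightarrow> 'k mpol) module" where
  "mpoly_free n S \<equiv> free_module (mpoly_ring n) S"

lemma mpoly_free_carrierD: "\<phi> \<in> carrier (mpoly_free n S) \<Longrightarrow> \<phi> p \<in> carrier (mpoly_ring n)"
  by (simp add: free_module_carrier)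

text \<open>Each entry of a boundary is a signed sum of multiples of the variables, in every degree.
  Together with the next lemma this identifies the boundaries of degree 0.\<close>

lemma koszul_free_in_var_ideal:
  fixes b :: "bool list \<Rightarrow> 'p \<Rightarrow> 'k::field mpol"
  assumes "\<And>s. b s \<in> carrier (mpoly_free n S)" "set vs \<subseteq> V" "set vs \<subseteq> {..<n}"
  shows "in_var_ideal V (koszul (mpoly_free n S) (map mvar vs) b s p)"
  using assms
proof (induction vs arbitrary: b s)
  case Nil
  then show ?case by (simp add: in_var_ideal_def)
next
  case (Cons v vs)
  interpret cring "mpoly_ring n :: 'k mpol ring" by (rule mpoly_ring_cring)
  interpret F: module "mpoly_ring n :: 'k mpol ring" "mpoly_free n S" by (rule free_module_is_module)
  show ?case
  proof (cases s)
    case Nil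
    then show ?thesis by (simp add: in_var_ideal_def)
  next
    case (Cons a t)
    have IH: "in_var_ideal V (koszul (mpoly_free n S) (map mvar vs) (\<lambda>t. b (a # t)) t p)"
      using Cons.prems by (intro Cons.IH) auto
    have cl: "koszul (mpoly_free n S) (map mvar vs) (\<lambda>t. b (a # t)) t \<in> carrier (mpoly_free n S)"
      using Cons.prems by (intro F.koszul_closed) (auto intro: mvar_closed)
    have "(\<ominus>\<^bsub>mpoly_free n S\<^esub> koszul (mpoly_free n S) (map mvar vs) (\<lambda>t. b (a # t)) t) p =
        - koszul (mpoly_free n S) (map mvar vs) (\<lambda>t. b (a # t)) t p"
      by (simp add: free_module_uminus[OF cl] mpoly_ring_uminus[OF mpoly_free_carrierD[OF cl]])
    then show ?thesis
      using IH Cons Cons.prems(2)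
      by (cases a) (auto intro: in_var_ideal_uminus in_var_ideal_add in_var_ideal_mvar_mult)
  qed
qed

text \<open>Division by the first variable, entry by entry: the quotient goes into the
  \<open>True\<close> half of the chain, the remainder lies in the ideal of the other variables and
  is treated by induction.\<close>

lemma koszul_free_var_ideal_image:
  fixes e :: "bool list \<Rightarrow> 'p \<Rightarrow> 'k::field mpol"
  assumes "e \<in> koszul_chain (mpoly_free n S) (length vs) 0" "set vs \<subseteq> {..<n}"
    and "\<And>s p. in_var_ideal (set vs) (e s p)"
  shows "\<exists>b\<in>koszul_chain (mpoly_free n S) (length vs) 1.
    \<forall>s. e s = koszul (mpoly_free n S) (map mvar vs) b s"
  using assms
proof (induction vs arbitrary: e)
  case Nil
  interpret cring "mpoly_ring n :: 'k mpol ring" by (rule mpoly_ring_cring)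
  interpret F: module "mpoly_ring n :: 'k mpol ring" "mpoly_free n S" by (rule free_module_is_module)
  have "e s = (\<lambda>p. 0)" for s
    using Nil(3)[of s] by (auto simp: in_var_ideal_def fun_eq_iff)
  then show ?case by (intro bexI[OF _ F.koszul_chain_zero]) simp
next
  case (Cons v vs)
  interpret cring "mpoly_ring n :: 'k mpol ring" by (rule mpoly_ring_cring)
  let ?F = "mpoly_free n S :: ('k mpol, 'p \<Rightarrow> 'k mpol) module"
  interpret F: module "mpoly_ring n :: 'k mpol ring" ?F by (rule free_module_is_module)
  have vs: "set (map mvar vs) \<subseteq> carrier (mpoly_ring n :: 'k mpol ring)" "v < n"
    using Cons.prems(2) by (auto intro: mvar_closed)
  define eF where "eF = (\<lambda>t. e (False # t))"
  define bT where "bT = (\<lambda>t p. div_var v (eF t p))"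
  define eR where "eR = (\<lambda>t p. eF t p - mvar v * div_var v (eF t p))"
  have eF: "eF \<in> koszul_chain ?F (length vs) 0"
    using F.koszul_chain_tail[of e "length vs" 0 False] Cons.prems(1) by (simp add: eF_def)
  note eFc = F.koszul_chainD(1)[OF eF]
  have bTc: "bT t \<in> carrier ?F" for t
    unfolding bT_def by (rule free_module_map[OF eFc]) (auto intro: div_var_closed)
  have bT: "bT \<in> koszul_chain ?F (length vs) 0"
    using bTc F.koszul_chainD(2)[OF eF] by (fastforce simp: koszul_chain_def bT_def)
  have "eR t \<in> carrier ?F" for t
  proof -
    have "(\<lambda>p. - (mvar v * bT t p)) \<in> carrier ?F"
      by (rule free_module_map[OF bTc])
        (auto intro!: mpoly_ring_uminus_closed mpoly_ring_mult_closed mvar_closed vs(2))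
    from free_module_add_closed[OF eFc this] show ?thesis
      by (simp add: eR_def bT_def)
  qed
  then have eR: "eR \<in> koszul_chain ?F (length vs) 0"
    using F.koszul_chainD(2)[OF eF] by (fastforce simp: koszul_chain_def eR_def)
  have "in_var_ideal (set vs) (eR t p)" for t p
    unfolding eR_def using Cons.prems(3)[of "False # t" p]
    by (intro in_var_ideal_remainder) (simp add: eF_def)
  from Cons.IH[OF eR _ this] Cons.prems(2) obtain b
    where b: "b \<in> koszul_chain ?F (length vs) 1" "\<And>s. eR s = koszul ?F (map mvar vs) b s"
    by auto
  let ?j = "F.koszul_join b bT"
  have "?j \<in> koszul_chain ?F (length (v # vs)) 1"
    using F.koszul_chain_join[OF b(1), of bT] bT by simp
  moreover have "e s = koszul ?F (map mvar (v # vs)) ?j s" for s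
  proof (cases s)
    case Nil
    then show ?thesis using F.koszul_chainD(2)[OF Cons.prems(1), of "[]"] by simp
  next
    case (Cons a t)
    show ?thesis
    proof (cases a)
      \<comment> \<open>Since \<open>bT\<close> has degree 0, its boundary vanishes, and so does
        \<open>e\<close> at a list that counts a \<open>True\<close>.\<close>
      case True
      have "koszul ?F (map mvar vs) bT t = \<zero>\<^bsub>?F\<^esub>"
        using F.koszul_bottom[OF vs(1)] bT by simp
      moreover have "\<ominus>\<^bsub>?F\<^esub> \<zero>\<^bsub>?F\<^esub> = \<zero>\<^bsub>?F\<^esub>"
        by (simp del: free_module_simps)
      ultimately show ?thesis
        using Cons True F.koszul_chainD(2)[OF Cons.prems(1), of s] by simp
    next
      case False
      then show ?thesis using Cons b(2)[of t, symmetric]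
        by (simp add: eR_def bT_def eF_def)
    qed
  qed
  ultimately show ?case by blast
qed

text \<open>If \<open>mvar v\<close> times \<open>e\<close> is a boundary, its entries lie in the
  ideal of \<open>vs\<close>. As \<open>v\<close> is not in \<open>vs\<close> it cancels, and a
  degree 0 chain with entries in that ideal is again a boundary.\<close>

lemma koszul_regular_free:
  assumes "distinct vs" "set vs \<subseteq> {..<n}"
  shows "koszul_regular (mpoly_free n S :: ('k::field mpol, 'p \<Rightarrow> 'k mpol) module) (map mvar vs)"
  using assms
proof (induction vs)
  case Nil
  then show ?case by simp
next
  case (Cons v vs)
  interpret cring "mpoly_ring n :: 'k mpol ring" by (rule mpoly_ring_cring)
  let ?F = "mpoly_free n S :: ('k mpol, 'p \<Rightarrow> 'k mpol) module"
  interpret F: module "mpoly_ring n :: 'k mpol ring" ?F by (rule free_module_is_module)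
  have "\<exists>b\<in>koszul_chain ?F (length vs) 1. \<forall>s. e s = koszul ?F (map mvar vs) b s"
    if a: "a \<in> koszul_chain ?F (length vs) 1" and e: "e \<in> koszul_chain ?F (length vs) 0"
      and ae: "\<forall>s. mvar v \<odot>\<^bsub>?F\<^esub> e s = koszul ?F (map mvar vs) a s" for a e
  proof (rule koszul_free_var_ideal_image[OF e])
    fix s p
    have "in_var_ideal (set vs) (koszul ?F (map mvar vs) a s p)"
      using Cons.prems F.koszul_chainD(1)[OF a] by (intro koszul_free_in_var_ideal) auto
    then have "in_var_ideal (set vs) (mvar v * e s p)"
      using ae[rule_format, of s, symmetric] by simp
    then show "in_var_ideal (set vs) (e s p)"
      by (rule in_var_ideal_cancel) (use Cons.prems in simp)
  qed (use Cons.prems in simp)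
  moreover have "koszul_regular ?F (map mvar vs)"
    using Cons by simp
  ultimately show ?case by (simp del: free_module_simps)
qed

text \<open>The basis \<open>S\<close> may be infinite, since the projective modules to be covered
  are retracts of free modules on their whole underlying sets.\<close>

lemma koszul_acyclic_free:
  "koszul_acyclic (mpoly_ring n) (mpoly_free n S :: ('k::field mpol, 'p \<Rightarrow> 'k mpol) module) (map mvar [0..<n])"
proof -
  interpret cring "mpoly_ring n :: 'k mpol ring" by (rule mpoly_ring_cring)
  interpret F: module "mpoly_ring n :: 'k mpol ring" "mpoly_free n S :: ('k mpol, 'p \<Rightarrow> 'k mpol) module"
    by (rule free_module_is_module)
  show ?thesis
    unfolding koszul_acyclic_def
    by (intro allI impI ballI F.koszul_exact koszul_regular_free) (auto intro: mvar_closed)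
qed

section \<open>Projective dimension in the presence of a socle element\<close>

theorem proj_dim_ge:
  fixes M :: "('k::field mpol, 'm) module"
  assumes M: "module (mpoly_ring n) M"
    and z: "z \<in> carrier M" "z \<noteq> \<zero>\<^bsub>M\<^esub>" "\<And>i. i < n \<Longrightarrow> mvar i \<odot>\<^bsub>M\<^esub> z = \<zero>\<^bsub>M\<^esub>"
  shows "ereal (real n) \<le> proj_dim (mpoly_ring n) M"
proof -
  have "n \<le> d"
    if res: "projective_resolution (mpoly_ring n) M P D \<epsilon>"
      and zero: "\<forall>i>d. carrier (P i) = {\<zero>\<^bsub>P i\<^esub>}"
    for d and P :: "nat \<Rightarrow> ('k mpol, ('m \<times> 'k mpol) list \<Rightarrow> 'k mpol) module" and D \<epsilon>
  proof -
    have xs: "set (map mvar [0..<n]) \<subseteq> carrier (mpoly_ring n :: 'k mpol ring)"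
      by (auto intro: mvar_closed)
    have "projective_module (mpoly_ring n) (P i)" for i
      using res unfolding projective_resolution_def by (elim conjE) (rule spec)
    then have acyclic: "koszul_acyclic (mpoly_ring n) (P i) (map mvar [0..<n])" for i
      by (rule koszul_acyclic_projective[OF _ xs koszul_acyclic_free])
    have "length (map mvar [0..<n] :: 'k mpol list) \<le> d"
      by (rule projective_length_ge[OF M res xs acyclic _ z(1,2)]) (use zero z(3) in auto)
    then show ?thesis by simp
  qed
  \<comment> \<open>This excludes the value \<open>-\<infinity>\<close> of the zero module. If there
    is no finite resolution, the infimum over the empty set is \<open>\<infinity>\<close> and the
    bound holds as well.\<close>
  moreover have "carrier M \<noteq> {\<zero>\<^bsub>M\<^esub>}" using z by auto
  ultimately show ?thesis
    unfolding proj_dim_def by (auto intro!: Inf_greatest)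
qed

lemma quotient_module_is_module:
  assumes "cring R" "ideal I R"
  shows "module R (quotient_module R I)"
proof -
  interpret I: ideal I R by fact
  interpret R: cring R by fact
  interpret Q: cring "R Quot I" using I.quotient_is_cring[OF R.is_cring] .
  interpret h: ring_hom_ring R "R Quot I" "(+>\<^bsub>R\<^esub>) I" by (rule I.rcos_ring_hom_ring)
  have eqs: "carrier (quotient_module R I) = carrier (R Quot I)"
    "add (quotient_module R I) = add (R Quot I)" "zero (quotient_module R I) = zero (R Quot I)"
    "\<And>a C. a \<odot>\<^bsub>quotient_module R I\<^esub> C = (I +>\<^bsub>R\<^esub> a) \<otimes>\<^bsub>R Quot I\<^esub> C"
    by (simp_all add: quotient_module_def)
  show ?thesis
  proof (rule moduleI)
    show "abelian_group (quotient_module R I)"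
      by (rule abelian_groupI)
        (auto simp: eqs Q.a_ac intro: Q.add.l_inv_ex)
  qed (auto simp: eqs assms Q.l_distr Q.r_distr Q.m_assoc)
qed

theorem proj_dim_quotient_ge:
  assumes I: "ideal I (mpoly_ring n)" and f: "f \<in> carrier (mpoly_ring n)" "f \<notin> I"
    and socle: "\<And>i. i < n \<Longrightarrow> mvar i * f \<in> I"
  shows "ereal (real n) \<le> proj_dim (mpoly_ring n) (quotient_module (mpoly_ring n) (I :: 'k::field mpol set))"
proof (rule proj_dim_ge)
  let ?R = "mpoly_ring n :: 'k mpol ring"
  let ?z = "I +>\<^bsub>?R\<^esub> f"
  interpret I: ideal I ?R by fact
  interpret R: cring ?R by (rule mpoly_ring_cring)
  interpret h: ring_hom_ring ?R "?R Quot I" "(+>\<^bsub>?R\<^esub>) I" by (rule I.rcos_ring_hom_ring)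
  show "module ?R (quotient_module ?R I)"
    by (rule quotient_module_is_module[OF mpoly_ring_cring I])
  show "?z \<in> carrier (quotient_module ?R I)"
    using h.hom_closed[OF f(1)] by (simp add: quotient_module_def)
  have z: "zero (quotient_module ?R I) = I"
    by (simp add: quotient_module_def FactRing_def)
  show "?z \<noteq> zero (quotient_module ?R I)"
    using I.a_rcos_self[OF f(1)] f(2) unfolding z by auto
  fix i assume i: "i < n"
  have "mvar i \<odot>\<^bsub>quotient_module ?R I\<^esub> ?z = I +>\<^bsub>?R\<^esub> (mvar i * f)"
    using h.hom_mult[OF mvar_closed[OF i] f(1)] by (simp add: quotient_module_def)
  also have "\<dots> = I" using socle[OF i] by (rule I.a_rcos_const)
  finally show "mvar i \<odot>\<^bsub>quotient_module ?R I\<^esub> ?z = zero (quotient_module ?R I)" unfolding z .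
qed

section \<open>Doubling the variables\<close>

lemma mpol_induct [case_names single add]:
  fixes p :: "'k::field mpol"
  assumes single: "\<And>m c. P (Poly_Mapping.single m c)" and add: "\<And>p q. P p \<Longrightarrow> P q \<Longrightarrow> P (p + q)"
  shows "P p"
proof -
  have "P (\<Sum>m\<in>A. Poly_Mapping.single m (Poly_Mapping.lookup p m))" if "finite A" for A
    using that
  proof induction
    case empty
    then show ?case using single[of 0 0] by simp
  next
    case (insert x A)
    then show ?case by (simp add: single add)
  qed
  moreover have "(\<Sum>m\<in>Poly_Mapping.keys p. Poly_Mapping.single m (Poly_Mapping.lookup p m)) = p"
    by (rule poly_mapping_eqI) (auto simp: lookup_sum lookup_single when_def in_keys_iff)
  ultimately show ?thesis by (metis finite_keys)
qed

text \<open>Extension by linearity from monomials, with scalars as constant polynomials. Both maps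
  below are of this kind; the one going down is not multiplicative, so it is no
  substitution.\<close>

definition lin_ext :: "((nat \<Rightarrow>\<^sub>0 nat) \<Rightarrow> 'k::field mpol) \<Rightarrow> 'k mpol \<Rightarrow> 'k mpol" where
  "lin_ext g p = (\<Sum>m\<in>Poly_Mapping.keys p. Poly_Mapping.single 0 (Poly_Mapping.lookup p m) * g m)"

lemma lin_ext_add: "lin_ext g (p + q) = lin_ext g p + lin_ext g q"
  unfolding lin_ext_def
  by (rule setsum_keys_plus_distrib) (simp_all add: single_add algebra_simps)

lemma lin_ext_single: "lin_ext g (Poly_Mapping.single m c) = Poly_Mapping.single 0 c * g m"
  by (simp add: lin_ext_def)

lemma lin_ext_0 [simp]: "lin_ext g 0 = 0"
  by (simp add: lin_ext_def)

lemma lin_ext_diff: "lin_ext g (p - q) = lin_ext g p - lin_ext g q"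
  using lin_ext_add[of g "p - q" q] by simp

lemma lin_ext_closed:
  assumes "\<And>m. m \<in> Poly_Mapping.keys p \<Longrightarrow> g m \<in> carrier (mpoly_ring n)"
  shows "lin_ext g p \<in> carrier (mpoly_ring n)"
proof -
  have "(\<Sum>m\<in>A. Poly_Mapping.single 0 (Poly_Mapping.lookup p m) * g m) \<in> carrier (mpoly_ring n)"
    if "finite A" "A \<subseteq> Poly_Mapping.keys p" for A
    using that
  proof induction
    case empty
    then show ?case by (simp add: mpoly_ring_carrier)
  next
    case (insert x A)
    have "Poly_Mapping.single 0 (Poly_Mapping.lookup p x) * g x \<in> carrier (mpoly_ring n)"
      using assms[of x] insert by (intro mpoly_ring_mult_closed) (auto simp: mpoly_ring_carrier)
    then show ?case using insert by (simp add: mpoly_ring_add_closed)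
  qed
  then show ?thesis by (simp add: lin_ext_def)
qed

section \<open>The substitution and its linear retraction\<close>

lift_definition double_exp :: "(nat \<Rightarrow>\<^sub>0 nat) \<Rightarrow> (nat \<Rightarrow>\<^sub>0 nat)" is "\<lambda>m i. m (i div 2)"
proof -
  fix m :: "nat \<Rightarrow> nat" assume "finite {i. m i \<noteq> 0}"
  moreover have "{i. m (i div 2) \<noteq> 0} \<subseteq> (\<lambda>j. 2 * j) ` {i. m i \<noteq> 0} \<union> (\<lambda>j. 2 * j + 1) ` {i. m i \<noteq> 0}"
  proof
    fix i assume "i \<in> {i. m (i div 2) \<noteq> 0}"
    moreover have "i = 2 * (i div 2) \<or> i = 2 * (i div 2) + 1" by presburger
    ultimately show "i \<in> (\<lambda>j. 2 * j) ` {i. m i \<noteq> 0} \<union> (\<lambda>j. 2 * j + 1) ` {i. m i \<noteq> 0}" by blast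
  qed
  ultimately show "finite {i. m (i div 2) \<noteq> 0}" by (auto intro: finite_subset)
qed

text \<open>Rounding down sends the product of all \<open>x_i\<close> and that of all
  \<open>y_i\<close> to 1, while a factor \<open>x_i y_i\<close> still counts exactly once.\<close>

lift_definition halve_exp :: "(nat \<Rightarrow>\<^sub>0 nat) \<Rightarrow> (nat \<Rightarrow>\<^sub>0 nat)" is
  "\<lambda>m i. (m (2 * i) + m (2 * i + 1)) div 2"
proof -
  fix m :: "nat \<Rightarrow> nat" assume "finite {i. m i \<noteq> 0}"
  moreover have "{i. (m (2 * i) + m (2 * i + 1)) div 2 \<noteq> 0} \<subseteq> (\<lambda>i. i div 2) ` {i. m i \<noteq> 0}"
  proof
    fix i assume "i \<in> {i. (m (2 * i) + m (2 * i + 1)) div 2 \<noteq> 0}"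
    then have "m (2 * i) \<noteq> 0 \<or> m (2 * i + 1) \<noteq> 0" by auto
    then show "i \<in> (\<lambda>i. i div 2) ` {i. m i \<noteq> 0}"
      by (auto intro: image_eqI[of _ _ "2 * i"] image_eqI[of _ _ "2 * i + 1"])
  qed
  ultimately show "finite {i. (m (2 * i) + m (2 * i + 1)) div 2 \<noteq> 0}"
    by (auto intro: finite_subset)
qed

lemma double_exp_add: "double_exp (a + b) = double_exp a + double_exp b"
  by (rule poly_mapping_eqI) (simp add: double_exp.rep_eq lookup_add)

lemma halve_exp_double: "halve_exp (double_exp a + b) = a + halve_exp b"
  by (rule poly_mapping_eqI) (simp add: double_exp.rep_eq halve_exp.rep_eq lookup_add)

lemma inj_double_exp: "inj double_exp"
proof (rule injI)
  fix a b assume "double_exp a = double_exp b"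
  then have "halve_exp (double_exp a + 0) = halve_exp (double_exp b + 0)" by simp
  then show "a = b" unfolding halve_exp_double by (rule add_right_imp_eq)
qed

text \<open>
  The substitution \<open>x\<^sub>i \<mapsto> x\<^sub>i y\<^sub>i\<close>, where the new \<open>x\<^sub>i\<close> and \<open>y\<^sub>i\<close> have the indices \<open>2 i\<close> and \<open>2 i + 1\<close>.
\<close>

definition double_vars :: "'k::field mpol \<Rightarrow> 'k mpol" where
  "double_vars = lin_ext (\<lambda>m. Poly_Mapping.single (double_exp m) 1)"

text \<open>Replacing the product of the \<open>x_i\<close> by that of the \<open>y_i\<close> in a
  monomial lowers every difference of exponents by 2. Equality of all differences is preserved, as
  is the parity of their common value; \<open>C\<close> selects among these values.\<close>

definition line_exps :: "nat \<Rightarrow> int set \<Rightarrow> (nat \<Rightarrow>\<^sub>0 nat) set" where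
  "line_exps n C = {m. \<exists>c\<in>C. \<forall>i<n.
     int (Poly_Mapping.lookup m (2 * i)) - int (Poly_Mapping.lookup m (2 * i + 1)) = c}"

text \<open>
  This linear map sends \<open>x\<^sup>a y\<^sup>b\<close> to \<open>t\<close> to the power \<open>\<lfloor>(a + b) / 2\<rfloor>\<close> if \<open>a - b\<close> is a constant vector
  with value in \<open>C\<close>, and to \<open>0\<close> otherwise. It is linear over \<open>k[t]\<close> acting through \<open>t\<^sub>i = x\<^sub>i y\<^sub>i\<close>, and it
  annihilates the multiples of the added binomial if \<open>C\<close> is the set of even or of odd integers. Hence
  it detects membership in the ideal before doubling.
\<close>

definition halve_vars :: "nat \<Rightarrow> int set \<Rightarrow> 'k::field mpol \<Rightarrow> 'k mpol" where
  "halve_vars n C = lin_ext (\<lambda>m. if m \<in> line_exps n C then Poly_Mapping.single (halve_exp m) 1 else 0)"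

lemma double_vars_single:
  "double_vars (Poly_Mapping.single m c) = Poly_Mapping.single (double_exp m) c"
  by (simp add: double_vars_def lin_ext_single mult_single)

lemma halve_vars_single:
  "halve_vars n C (Poly_Mapping.single m c) =
    (if m \<in> line_exps n C then Poly_Mapping.single (halve_exp m) c else 0)"
  by (simp add: halve_vars_def lin_ext_single mult_single)

lemmas double_vars_add = lin_ext_add[of "\<lambda>m. Poly_Mapping.single (double_exp m) 1", folded double_vars_def]

lemma halve_vars_add: "halve_vars n C (p + q) = halve_vars n C p + halve_vars n C q"
  by (simp add: halve_vars_def lin_ext_add)

lemma halve_vars_diff: "halve_vars n C (p - q) = halve_vars n C p - halve_vars n C q"
  by (simp add: halve_vars_def lin_ext_diff)

lemma double_vars_mult: "double_vars (p * q) = double_vars p * double_vars q"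
proof (induction p rule: mpol_induct)
  case (single a c)
  show ?case
    by (induction q rule: mpol_induct)
      (simp_all add: mult_single double_vars_single double_exp_add double_vars_add distrib_left)
next
  case (add p q)
  then show ?case by (simp add: double_vars_add distrib_right)
qed

lemma line_exps_double: "double_exp a + b \<in> line_exps n C \<longleftrightarrow> b \<in> line_exps n C"
  by (simp add: line_exps_def lookup_add double_exp.rep_eq)

text \<open>Bilinear, hence checked on terms: a factor with exponent \<open>double_exp a\<close>
  leaves the differences alone and raises the halved sums by exactly \<open>a\<close>.\<close>

lemma halve_vars_double_mult: "halve_vars n C (double_vars p * q) = p * halve_vars n C q"
proof (induction p rule: mpol_induct)
  case (single a c)
  show ?case
  proof (induction q rule: mpol_induct)
    case (single b d)
    show ?case
      by (simp add: mult_single double_vars_single halve_vars_single halve_exp_double line_exps_double)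
  next
    case (add p q)
    then show ?case by (simp add: halve_vars_add distrib_left)
  qed
next
  case (add p q)
  then show ?case by (simp add: double_vars_add halve_vars_add distrib_right)
qed

lemma halve_vars_closed:
  assumes "p \<in> carrier (mpoly_ring (2 * n))"
  shows "halve_vars n C p \<in> carrier (mpoly_ring n)"
  unfolding halve_vars_def
proof (rule lin_ext_closed)
  fix m assume "m \<in> Poly_Mapping.keys p"
  then have m: "Poly_Mapping.keys m \<subseteq> {..<2 * n}" using assms by (simp add: mpoly_ring_carrier)
  have "i < n" if "i \<in> Poly_Mapping.keys (halve_exp m)" for i
  proof -
    have "2 * i \<in> Poly_Mapping.keys m \<or> 2 * i + 1 \<in> Poly_Mapping.keys m"
      using that by (auto simp: in_keys_iff halve_exp.rep_eq)
    then show "i < n" using m by auto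
  qed
  then show "(if m \<in> line_exps n C then Poly_Mapping.single (halve_exp m) 1 else 0) \<in> carrier (mpoly_ring n)"
    by (auto simp: mpoly_ring_carrier)
qed

lemma double_exp_keys:
  assumes "Poly_Mapping.keys m \<subseteq> {..<n}"
  shows "Poly_Mapping.keys (double_exp m) \<subseteq> {..<2 * n}"
proof
  fix i assume "i \<in> Poly_Mapping.keys (double_exp m)"
  then have "i div 2 \<in> Poly_Mapping.keys m" by (simp add: in_keys_iff double_exp.rep_eq)
  with assms have "i div 2 < n" by auto
  then show "i \<in> {..<2 * n}" by auto
qed

lemma double_vars_closed:
  "p \<in> carrier (mpoly_ring n) \<Longrightarrow> double_vars p \<in> carrier (mpoly_ring (2 * n))"
  unfolding double_vars_def
  by (rule lin_ext_closed) (use double_exp_keys in \<open>auto simp: mpoly_ring_carrier\<close>)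

lemma lookup_double_vars: "Poly_Mapping.lookup (double_vars p) (double_exp m) = Poly_Mapping.lookup p m"
  by (induction p rule: mpol_induct)
    (simp_all add: double_vars_single double_vars_add lookup_add lookup_single
      inj_eq[OF inj_double_exp])

text \<open>No two terms merge, as \<open>double_exp\<close> is injective. This preserves the number
  of monomials of each generator and, with degrees doubled, homogeneity.\<close>

lemma keys_double_vars: "Poly_Mapping.keys (double_vars p) = double_exp ` Poly_Mapping.keys p"
proof
  show "Poly_Mapping.keys (double_vars p) \<subseteq> double_exp ` Poly_Mapping.keys p"
  proof
    fix m assume m: "m \<in> Poly_Mapping.keys (double_vars p)"
    have "double_vars p = (\<Sum>k\<in>Poly_Mapping.keys p. Poly_Mapping.single (double_exp k) (Poly_Mapping.lookup p k))"
      by (simp add: double_vars_def lin_ext_def mult_single)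
    with m have "(\<Sum>k\<in>Poly_Mapping.keys p. Poly_Mapping.lookup p k when double_exp k = m) \<noteq> 0"
      by (simp add: in_keys_iff lookup_sum lookup_single)
    then obtain k where "k \<in> Poly_Mapping.keys p" "(Poly_Mapping.lookup p k when double_exp k = m) \<noteq> 0"
      by (rule sum.not_neutral_contains_not_neutral)
    then show "m \<in> double_exp ` Poly_Mapping.keys p" by (auto simp: when_def split: if_splits)
  qed
qed (auto simp: in_keys_iff lookup_double_vars)

lemma monomial_degree_alt:
  assumes "Poly_Mapping.keys m \<subseteq> {..<n}"
  shows "monomial_degree m = (\<Sum>i<n. Poly_Mapping.lookup m i)"
  unfolding monomial_degree_def using assms by (intro sum.mono_neutral_left) (auto simp: in_keys_iff)

lemma sum_double: "(\<Sum>i<2 * n. g i) = (\<Sum>i<n. g (2 * i) + g (2 * i + 1))" for g :: "nat \<Rightarrow> nat"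
  by (induction n) (simp_all add: algebra_simps)

lemma monomial_degree_double_exp: "monomial_degree (double_exp m) = 2 * monomial_degree m"
proof -
  obtain n where n: "Poly_Mapping.keys m \<subseteq> {..<n}"
    using finite_nat_iff_bounded[of "Poly_Mapping.keys m"] by auto
  show ?thesis
    using monomial_degree_alt[OF n] monomial_degree_alt[OF double_exp_keys[OF n]]
    by (simp add: sum_double double_exp.rep_eq sum.distrib)
qed

lemma homogeneous_double_vars: "homogeneous p \<Longrightarrow> homogeneous (double_vars p)"
  unfolding homogeneous_def keys_double_vars by (auto simp: monomial_degree_double_exp)

text \<open>The exponent vector of \<open>\<Prod>x\<^sub>i\<close> for \<open>r = 0\<close> and of \<open>\<Prod>y\<^sub>i\<close> for \<open>r = 1\<close>.\<close>

definition half_exp :: "nat \<Rightarrow> nat \<Rightarrow> (nat \<Rightarrow>\<^sub>0 nat)" where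
  "half_exp n r = (\<Sum>j<n. Poly_Mapping.single (2 * j + r) 1)"

definition half_prod :: "nat \<Rightarrow> nat \<Rightarrow> 'k::field mpol" where
  "half_prod n r = Poly_Mapping.single (half_exp n r) 1"

lemma lookup_half_exp:
  assumes "r < 2" "r' < 2"
  shows "Poly_Mapping.lookup (half_exp n r) (2 * i + r') = (if i < n \<and> r' = r then 1 else 0)"
proof -
  have "(2 * j + r = 2 * i + r') = (j = i \<and> r' = r)" for j
    using assms by presburger
  then have "Poly_Mapping.lookup (half_exp n r) (2 * i + r') = (\<Sum>j<n. 1 when j = i \<and> r' = r)"
    by (simp add: half_exp_def lookup_sum lookup_single)
  also have "\<dots> = (if i < n \<and> r' = r then 1 else 0)"
    by (auto simp: when_def)
  finally show ?thesis .
qed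

lemma lookup_half_exp_simps [simp]:
  "Poly_Mapping.lookup (half_exp n 0) (2 * i) = (if i < n then 1 else 0)"
  "Poly_Mapping.lookup (half_exp n 0) (Suc (2 * i)) = 0"
  "Poly_Mapping.lookup (half_exp n 1) (2 * i) = 0"
  "Poly_Mapping.lookup (half_exp n (Suc 0)) (2 * i) = 0"
  "Poly_Mapping.lookup (half_exp n 1) (Suc (2 * i)) = (if i < n then 1 else 0)"
  "Poly_Mapping.lookup (half_exp n (Suc 0)) (Suc (2 * i)) = (if i < n then 1 else 0)"
  using lookup_half_exp[of 0 0 n i] lookup_half_exp[of 0 1 n i] lookup_half_exp[of 1 0 n i]
    lookup_half_exp[of 1 1 n i] by simp_all

lemma keys_half_exp:
  assumes "r < 2" shows "Poly_Mapping.keys (half_exp n r) \<subseteq> {..<2 * n}"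
proof
  fix i assume "i \<in> Poly_Mapping.keys (half_exp n r)"
  then have "Poly_Mapping.lookup (half_exp n r) (2 * (i div 2) + i mod 2) \<noteq> 0"
    by (simp add: in_keys_iff)
  then show "i \<in> {..<2 * n}"
    using lookup_half_exp[OF assms, of "i mod 2" n "i div 2"] by (auto split: if_splits)
qed

lemma half_prod_closed: "r < 2 \<Longrightarrow> half_prod n r \<in> carrier (mpoly_ring (2 * n))"
  using keys_half_exp[of r n] by (simp add: half_prod_def mpoly_ring_carrier)

lemma monomial_degree_half_exp:
  assumes "r < 2" shows "monomial_degree (half_exp n r) = n"
proof -
  have "r = 0 \<or> r = 1" using assms by auto
  then have "(\<Sum>i<2 * n. Poly_Mapping.lookup (half_exp n r) i) = n"
    unfolding sum_double by auto
  then show ?thesis using monomial_degree_alt[OF keys_half_exp[OF assms]] by simp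
qed

lemma half_exp_neq: "n > 0 \<Longrightarrow> half_exp n 0 \<noteq> half_exp n 1"
  using lookup_half_exp[of 0 0 n 0] lookup_half_exp[of 1 0 n 0] by force

lemma keys_half_prod_diff:
  "n > 0 \<Longrightarrow> Poly_Mapping.keys (half_prod n 0 - half_prod n 1 :: 'k::field mpol) = {half_exp n 0, half_exp n 1}"
  using half_exp_neq[of n]
  by (auto simp: half_prod_def in_keys_iff lookup_minus lookup_single when_def split: if_splits)

lemma homogeneous_half_prod_diff:
  "n > 0 \<Longrightarrow> homogeneous (half_prod n 0 - half_prod n 1 :: 'k::field mpol)"
  unfolding homogeneous_def
  by (auto simp: keys_half_prod_diff monomial_degree_half_exp simp del: One_nat_def)

text \<open>The product of all \<open>x_j\<close> contains \<open>x_i\<close>, so times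
  \<open>y_i\<close> it contains \<open>x_i y_i\<close>, the image of \<open>mvar i\<close>;
  likewise with the halves exchanged. The index \<open>1 - r\<close> picks the opposite
  half.\<close>

lemma mvar_mult_half_prod:
  assumes "i < n" "r < 2"
  obtains w where "w \<in> carrier (mpoly_ring (2 * n))"
    "mvar (2 * i + (1 - r)) * half_prod n r = double_vars (mvar i) * w"
proof
  define a where "a = (\<Sum>j\<in>{..<n} - {i}. Poly_Mapping.single (2 * j + r) (1::nat))"
  have h: "half_exp n r = Poly_Mapping.single (2 * i + r) 1 + a"
    unfolding half_exp_def a_def using assms by (simp add: sum.remove)
  have "Poly_Mapping.keys a \<subseteq> Poly_Mapping.keys (half_exp n r)"
    unfolding h by (auto simp: in_keys_iff lookup_add)
  then show "Poly_Mapping.single a 1 \<in> carrier (mpoly_ring (2 * n))"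
    using keys_half_exp[OF assms(2), of n] by (auto simp: mpoly_ring_carrier)
  have "Poly_Mapping.single (2 * i + (1 - r)) 1 + Poly_Mapping.single (2 * i + r) 1 =
      double_exp (Poly_Mapping.single i 1)"
  proof (rule poly_mapping_eqI)
    fix k
    have "r = 0 \<or> r = 1" using assms by auto
    moreover have "i = k div 2 \<longleftrightarrow> k = 2 * i \<or> k = 2 * i + 1" by auto
    ultimately show "Poly_Mapping.lookup (Poly_Mapping.single (2 * i + (1 - r)) 1 + Poly_Mapping.single (2 * i + r) 1) k =
      Poly_Mapping.lookup (double_exp (Poly_Mapping.single i 1)) k"
      by (auto simp: double_exp.rep_eq lookup_add lookup_single when_def)
  qed
  then show "mvar (2 * i + (1 - r)) * half_prod n r = double_vars (mvar i) * Poly_Mapping.single a 1"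
    by (simp add: mvar_def half_prod_def h mult_single double_vars_single add.assoc[symmetric])
qed

lemma line_exps_half:
  assumes "n > 0"
  shows "0 \<in> line_exps n C \<longleftrightarrow> 0 \<in> C" "half_exp n 0 \<in> line_exps n C \<longleftrightarrow> 1 \<in> C"
    "half_exp n 1 \<in> line_exps n C \<longleftrightarrow> - 1 \<in> C"
  using assms by (auto simp: line_exps_def)

lemma halve_exp_half: "halve_exp (half_exp n 0 + a) = halve_exp (half_exp n 1 + a)"
  by (rule poly_mapping_eqI) (simp add: halve_exp.rep_eq lookup_add add_ac)

lemma halve_exp_half_0: "halve_exp (half_exp n 0) = 0"
  by (rule poly_mapping_eqI) (simp add: halve_exp.rep_eq)

text \<open>The two products have differences 1 and -1, so the same \<open>a\<close> meets
  \<open>C\<close> at values 2 apart. The sets of even and of odd integers are invariant under this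
  shift; \<open>{1}\<close> is not.\<close>

lemma line_exps_periodic:
  assumes "\<And>c. c + 2 \<in> C \<longleftrightarrow> c \<in> C"
  shows "half_exp n 0 + a \<in> line_exps n C \<longleftrightarrow> half_exp n 1 + a \<in> line_exps n C"
proof -
  let ?d = "\<lambda>i. int (Poly_Mapping.lookup a (2 * i)) - int (Poly_Mapping.lookup a (2 * i + 1))"
  have "half_exp n 0 + a \<in> line_exps n C \<longleftrightarrow> (\<exists>c\<in>C. \<forall>i<n. ?d i = c - 1)"
    unfolding line_exps_def mem_Collect_eq
    by (intro bex_cong all_cong1 imp_cong refl) (auto simp: lookup_add)
  also have "\<dots> \<longleftrightarrow> (\<exists>c\<in>C. \<forall>i<n. ?d i = c + 1)"
  proof
    assume "\<exists>c\<in>C. \<forall>i<n. ?d i = c - 1"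
    then obtain c where "c \<in> C" "\<forall>i<n. ?d i = c - 1" by blast
    then show "\<exists>c\<in>C. \<forall>i<n. ?d i = c + 1"
      using assms[of "c - 2"] by (intro bexI[of _ "c - 2"]) auto
  next
    assume "\<exists>c\<in>C. \<forall>i<n. ?d i = c + 1"
    then obtain c where "c \<in> C" "\<forall>i<n. ?d i = c + 1" by blast
    then show "\<exists>c\<in>C. \<forall>i<n. ?d i = c - 1"
      using assms[of c] by (intro bexI[of _ "c + 2"]) auto
  qed
  also have "\<dots> \<longleftrightarrow> half_exp n 1 + a \<in> line_exps n C"
    unfolding line_exps_def mem_Collect_eq
    by (intro bex_cong all_cong1 imp_cong refl) (auto simp: lookup_add)
  finally show ?thesis .
qed

text \<open>On a monomial multiple, both terms have the same halved exponent and are kept or dropped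
  together, so they cancel.\<close>

lemma halve_vars_half_prod_diff:
  fixes p :: "'k::field mpol"
  assumes "\<And>c. c + 2 \<in> C \<longleftrightarrow> c \<in> C"
  shows "halve_vars n C (p * (half_prod n 0 - half_prod n 1)) = 0"
proof (induction p rule: mpol_induct)
  case (single a c)
  show ?case
    by (simp add: half_prod_def right_diff_distrib mult_single halve_vars_diff halve_vars_single
        halve_exp_half[of n a] line_exps_periodic[OF assms, of n a] add.commute[of a])
next
  case (add p q)
  then show ?case by (simp add: distrib_right halve_vars_add)
qed

lemma halve_vars_double:
  fixes p :: "'k::field mpol"
  assumes "n > 0"
  shows "halve_vars n C (double_vars p) = (if 0 \<in> C then p else 0)"
proof -
  have "halve_exp 0 = 0" by (rule poly_mapping_eqI) (simp add: halve_exp.rep_eq)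
  then have "halve_vars n C 1 = (if 0 \<in> C then 1 else 0 :: 'k mpol)"
    using halve_vars_single[of n C 0 "1 :: 'k"] line_exps_half(1)[OF assms] by simp
  then show ?thesis using halve_vars_double_mult[of n C p 1] by simp
qed

lemma halve_vars_half_prod:
  "n > 0 \<Longrightarrow> halve_vars n C (half_prod n 0) = (if 1 \<in> C then 1 else 0)"
  "n > 0 \<Longrightarrow> - 1 \<notin> C \<Longrightarrow> halve_vars n C (half_prod n 1) = 0"
  by (simp_all add: half_prod_def halve_vars_single line_exps_half halve_exp_half_0 del: One_nat_def)

section \<open>Ideals with large projective dimension\<close>

lemma mpoly_idealI:
  fixes I :: "'k::field mpol set"
  assumes "I \<subseteq> carrier (mpoly_ring n)" "0 \<in> I" "\<And>a b. a \<in> I \<Longrightarrow> b \<in> I \<Longrightarrow> a + b \<in> I"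
    and "\<And>r a. r \<in> carrier (mpoly_ring n) \<Longrightarrow> a \<in> I \<Longrightarrow> r * a \<in> I"
  shows "ideal I (mpoly_ring n)"
proof -
  interpret cring "mpoly_ring n :: 'k mpol ring" by (rule mpoly_ring_cring)
  have neg: "\<ominus>\<^bsub>mpoly_ring n\<^esub> a \<in> I" if "a \<in> I" for a
    using assms(1) assms(4)[of "- 1" a] that mpoly_ring_uminus_closed[of 1 n]
    by (auto simp: mpoly_ring_uminus mpoly_ring_carrier)
  have right: "a * r \<in> I" if "r \<in> carrier (mpoly_ring n)" "a \<in> I" for r a
    using assms(4)[OF that] by (simp add: mult.commute)
  show ?thesis
  proof (rule idealI)
    show "subgroup I (add_monoid (mpoly_ring n))"
      using assms neg by (intro subgroup.intro) (auto simp: a_inv_def)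
  qed (use assms right in \<open>auto intro: ring_axioms\<close>)
qed

lemma mpoly_ideal_mult:
  "ideal I (mpoly_ring n) \<Longrightarrow> r \<in> carrier (mpoly_ring n) \<Longrightarrow> a \<in> I \<Longrightarrow> r * a \<in> I"
  using ideal.I_l_closed[of I "mpoly_ring n" a r] by simp

lemma mpoly_ideal_add:
  "ideal I (mpoly_ring n) \<Longrightarrow> a \<in> I \<Longrightarrow> b \<in> I \<Longrightarrow> a + b \<in> I"
  using additive_subgroup.a_closed[of I "mpoly_ring n" a b] by (simp add: ideal.axioms(1))

lemma mpoly_ideal_zero: "ideal I (mpoly_ring n) \<Longrightarrow> 0 \<in> I"
  using additive_subgroup.zero_closed[of I "mpoly_ring n"] by (simp add: ideal.axioms(1))

lemma mpoly_Idl_ideal: "F \<subseteq> carrier (mpoly_ring n) \<Longrightarrow> ideal (Idl\<^bsub>mpoly_ring n\<^esub> F) (mpoly_ring n)"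
  using ring.genideal_ideal cring.axioms(1)[OF mpoly_ring_cring] by blast

lemma mpoly_Idl_self: "F \<subseteq> carrier (mpoly_ring n) \<Longrightarrow> F \<subseteq> Idl\<^bsub>mpoly_ring n\<^esub> F"
  using ring.genideal_self cring.axioms(1)[OF mpoly_ring_cring] by blast

lemma mpoly_Idl_minimal: "ideal I (mpoly_ring n) \<Longrightarrow> F \<subseteq> I \<Longrightarrow> Idl\<^bsub>mpoly_ring n\<^esub> F \<subseteq> I"
  using ring.genideal_minimal cring.axioms(1)[OF mpoly_ring_cring] by blast

lemma halve_vars_0 [simp]: "halve_vars n C 0 = 0"
  by (simp add: halve_vars_def)

lemma double_vars_0 [simp]: "double_vars 0 = 0"
  by (simp add: double_vars_def)

lemma one_closed: "1 \<in> carrier (mpoly_ring n)"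
  by (simp add: mpoly_ring_carrier)

text \<open>As \<open>halve_vars\<close> is no ring homomorphism, the preimage of \<open>J\<close>
  need not be an ideal. The set \<open>?K\<close> of elements all of whose multiples land in
  \<open>J\<close> is one, which is why the hypothesis on the generators speaks of
  multiples.\<close>

lemma halve_vars_Idl:
  fixes J :: "'k::field mpol set"
  assumes J: "ideal J (mpoly_ring n)" and G: "G \<subseteq> carrier (mpoly_ring (2 * n))"
    and gen: "\<And>g r. g \<in> G \<Longrightarrow> r \<in> carrier (mpoly_ring (2 * n)) \<Longrightarrow> halve_vars n C (r * g) \<in> J"
    and q: "q \<in> Idl\<^bsub>mpoly_ring (2 * n)\<^esub> G"
  shows "halve_vars n C q \<in> J"
proof -
  let ?K = "{q \<in> carrier (mpoly_ring (2 * n)). \<forall>r\<in>carrier (mpoly_ring (2 * n)). halve_vars n C (r * q) \<in> J}"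
  have "ideal ?K (mpoly_ring (2 * n))"
  proof (rule mpoly_idealI)
    show "0 \<in> ?K" using mpoly_ideal_zero[OF J] by (simp add: mpoly_ring_carrier)
  next
    fix a b assume "a \<in> ?K" "b \<in> ?K"
    then show "a + b \<in> ?K"
      by (auto simp: mpoly_ring_add_closed distrib_left halve_vars_add intro: mpoly_ideal_add[OF J])
  next
    fix r a :: "'k mpol" assume "r \<in> carrier (mpoly_ring (2 * n))" "a \<in> ?K"
    then show "r * a \<in> ?K"
      by (auto simp: mpoly_ring_mult_closed mult.assoc[symmetric])
  qed auto
  then have "Idl\<^bsub>mpoly_ring (2 * n)\<^esub> G \<subseteq> ?K"
    by (rule mpoly_Idl_minimal) (use G gen in auto)
  with q have "halve_vars n C (1 * q) \<in> J" using one_closed by blast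
  then show ?thesis by simp
qed

lemma double_vars_Idl:
  fixes J :: "'k::field mpol set"
  assumes J: "ideal J (mpoly_ring (2 * n))" and F: "F \<subseteq> carrier (mpoly_ring n)"
    and gen: "double_vars ` F \<subseteq> J" and p: "p \<in> Idl\<^bsub>mpoly_ring n\<^esub> F"
  shows "double_vars p \<in> J"
proof -
  let ?K = "{p \<in> carrier (mpoly_ring n). double_vars p \<in> J}"
  have "ideal ?K (mpoly_ring n)"
    by (rule mpoly_idealI)
      (auto simp: mpoly_ring_carrier[of 0] mpoly_ideal_zero[OF J] mpoly_ring_add_closed
        mpoly_ring_mult_closed double_vars_add double_vars_mult double_vars_closed
        intro: mpoly_ideal_add[OF J] mpoly_ideal_mult[OF J])
  then have "Idl\<^bsub>mpoly_ring n\<^esub> F \<subseteq> ?K"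
    by (rule mpoly_Idl_minimal) (use F gen in auto)
  with p show ?thesis by blast
qed

text \<open>The invariant of the doubling. It keeps the generating set and not only the ideal,
  because the count and the minimality refer to it.\<close>

definition socle_example :: "nat \<Rightarrow> nat \<Rightarrow> 'k::field mpol set \<Rightarrow> 'k mpol \<Rightarrow> bool" where
  "socle_example n N F f \<longleftrightarrow>
    minimal_homogeneous_generators n (Idl\<^bsub>mpoly_ring n\<^esub> F) F \<and>
    (\<Sum>g\<in>F. card (Poly_Mapping.keys g)) = N \<and>
    f \<in> carrier (mpoly_ring n) \<and> f \<notin> Idl\<^bsub>mpoly_ring n\<^esub> F \<and>
    (\<forall>i<n. mvar i * f \<in> Idl\<^bsub>mpoly_ring n\<^esub> F)"

lemma minimal_homogeneous_generatorsI:
  assumes "finite F" "F \<subseteq> carrier (mpoly_ring n)" "\<And>f. f \<in> F \<Longrightarrow> homogeneous f"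
    and indep: "\<And>f. f \<in> F \<Longrightarrow> f \<notin> Idl\<^bsub>mpoly_ring n\<^esub> (F - {f})"
  shows "minimal_homogeneous_generators n (Idl\<^bsub>mpoly_ring n\<^esub> F) F"
  unfolding minimal_homogeneous_generators_def
proof (intro conjI allI impI notI)
  fix G assume G: "G \<subset> F" and eq: "Idl\<^bsub>mpoly_ring n\<^esub> G = Idl\<^bsub>mpoly_ring n\<^esub> F"
  then obtain f where f: "f \<in> F" "G \<subseteq> F - {f}" by blast
  have "F - {f} \<subseteq> carrier (mpoly_ring n)" using assms(2) by blast
  then have "Idl\<^bsub>mpoly_ring n\<^esub> G \<subseteq> Idl\<^bsub>mpoly_ring n\<^esub> (F - {f})"
    using f(2) by (intro mpoly_Idl_minimal mpoly_Idl_ideal) (use mpoly_Idl_self in blast)+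
  moreover have "f \<in> Idl\<^bsub>mpoly_ring n\<^esub> F" using mpoly_Idl_self[OF assms(2)] f(1) by blast
  ultimately show False using indep[OF f(1)] eq by blast
qed (use assms in auto)

lemma minimal_homogeneous_generators_indep:
  assumes "minimal_homogeneous_generators n I F" "f \<in> F"
  shows "f \<notin> Idl\<^bsub>mpoly_ring n\<^esub> (F - {f})"
proof
  assume f: "f \<in> Idl\<^bsub>mpoly_ring n\<^esub> (F - {f})"
  have F: "F \<subseteq> carrier (mpoly_ring n)" and I: "Idl\<^bsub>mpoly_ring n\<^esub> F = I"
    and min: "\<And>G. G \<subset> F \<Longrightarrow> Idl\<^bsub>mpoly_ring n\<^esub> G \<noteq> I"
    using assms(1) unfolding minimal_homogeneous_generators_def by auto
  have F': "F - {f} \<subseteq> carrier (mpoly_ring n)" using F by blast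
  have "F \<subseteq> Idl\<^bsub>mpoly_ring n\<^esub> (F - {f})" using f mpoly_Idl_self[OF F'] by blast
  then have "Idl\<^bsub>mpoly_ring n\<^esub> F \<subseteq> Idl\<^bsub>mpoly_ring n\<^esub> (F - {f})"
    by (rule mpoly_Idl_minimal[OF mpoly_Idl_ideal[OF F']])
  moreover have "Idl\<^bsub>mpoly_ring n\<^esub> (F - {f}) \<subseteq> Idl\<^bsub>mpoly_ring n\<^esub> F"
    using mpoly_Idl_self[OF F] by (intro mpoly_Idl_minimal mpoly_Idl_ideal F) blast
  ultimately show False using min[of "F - {f}"] assms(2) I by blast
qed

text \<open>The ideal of the variables in \<open>A\<close> consists of polynomials satisfying
  \<open>in_var_ideal A\<close>, which fails for 1 and for every variable outside
  \<open>A\<close>.\<close>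

lemma socle_example_vars: "socle_example n n (mvar ` {..<n}) (1 :: 'k::field mpol)"
proof -
  let ?X = "mvar :: nat \<Rightarrow> 'k mpol"
  have X: "?X ` A \<subseteq> carrier (mpoly_ring n)" if "A \<subseteq> {..<n}" for A
    using that by (auto intro: mvar_closed)
  have keys: "Poly_Mapping.keys (?X i) = {Poly_Mapping.single i 1}" for i
    by (simp add: mvar_def)
  have inj: "inj ?X"
  proof (rule injI)
    fix i j assume "?X i = ?X j"
    then have "Poly_Mapping.single i (1::nat) = Poly_Mapping.single j 1"
      using keys[of i] keys[of j] by simp
    then have "Poly_Mapping.keys (Poly_Mapping.single i (1::nat)) = Poly_Mapping.keys (Poly_Mapping.single j (1::nat))"
      by simp
    then show "i = j" by simp
  qed
  have Idl: "in_var_ideal A p" if "A \<subseteq> {..<n}" "p \<in> Idl\<^bsub>mpoly_ring n\<^esub> (?X ` A)" for A p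
  proof -
    have "ideal {p \<in> carrier (mpoly_ring n). in_var_ideal A (p :: 'k mpol)} (mpoly_ring n)"
    proof (rule mpoly_idealI)
      fix r a :: "'k mpol"
      assume r: "r \<in> carrier (mpoly_ring n)" and a: "a \<in> {p \<in> carrier (mpoly_ring n). in_var_ideal A p}"
      have "in_var_ideal A (r * a)"
        unfolding in_var_ideal_def
      proof
        fix m assume "m \<in> Poly_Mapping.keys (r * a)"
        then obtain s t where m: "m = s + t" "t \<in> Poly_Mapping.keys a"
          using keys_mult[of r a] by blast
        then obtain v where "v \<in> Poly_Mapping.keys t" "v \<in> A"
          using a unfolding in_var_ideal_def by blast
        then have "v \<in> Poly_Mapping.keys m" by (simp add: m(1) in_keys_iff lookup_add)
        with \<open>v \<in> A\<close> show "Poly_Mapping.keys m \<inter> A \<noteq> {}" by blast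
      qed
      then show "r * a \<in> {p \<in> carrier (mpoly_ring n). in_var_ideal A p}"
        using r a by (simp add: mpoly_ring_mult_closed)
    qed (auto simp: mpoly_ring_carrier[of 0] in_var_ideal_def[of _ 0] mpoly_ring_add_closed in_var_ideal_add)
    then have "Idl\<^bsub>mpoly_ring n\<^esub> (?X ` A) \<subseteq> {p \<in> carrier (mpoly_ring n). in_var_ideal A p}"
      by (rule mpoly_Idl_minimal) (use X[OF that(1)] in \<open>auto simp: in_var_ideal_def keys\<close>)
    with that(2) show ?thesis by blast
  qed
  have "minimal_homogeneous_generators n (Idl\<^bsub>mpoly_ring n\<^esub> (?X ` {..<n})) (?X ` {..<n})"
  proof (rule minimal_homogeneous_generatorsI)
    fix f assume "f \<in> ?X ` {..<n}"
    then obtain i where i: "f = ?X i" "i < n" by blast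
    then show "homogeneous f" by (auto simp: homogeneous_def keys)
    have "?X ` {..<n} - {f} = ?X ` ({..<n} - {i})"
      using inj by (auto simp: i inj_eq)
    moreover have "\<not> in_var_ideal ({..<n} - {i}) f" by (simp add: i in_var_ideal_def keys)
    ultimately show "f \<notin> Idl\<^bsub>mpoly_ring n\<^esub> (?X ` {..<n} - {f})"
      using Idl[of "{..<n} - {i}" f] by auto
  qed (use X in auto)
  moreover have "(\<Sum>g\<in>?X ` {..<n}. card (Poly_Mapping.keys g)) = n"
    using inj by (subst sum.reindex) (auto simp: keys inj_on_def)
  moreover have "1 \<notin> Idl\<^bsub>mpoly_ring n\<^esub> (?X ` {..<n})"
    using Idl[of "{..<n}" 1] by (auto simp: in_var_ideal_def)
  moreover have "?X i * 1 \<in> Idl\<^bsub>mpoly_ring n\<^esub> (?X ` {..<n})" if "i < n" for i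
    using mpoly_Idl_self[OF X[of "{..<n}"]] that by auto
  ultimately show ?thesis by (simp add: socle_example_def one_closed)
qed

text \<open>Three choices of \<open>C\<close> settle the non-memberships. \<open>{1}\<close> sends
  the binomial to 1 and multiples of the substituted generators into \<open>?I\<close>; the even
  numbers kill the multiples of the binomial and undo the substitution; the odd numbers kill them
  too and send the new socle element back to \<open>f\<close>.\<close>

lemma socle_example_double:
  fixes f :: "'k::field mpol"
  assumes n: "n > 0" and ex: "socle_example n N F f"
  shows "socle_example (2 * n) (N + 2) (insert (half_prod n 0 - half_prod n 1) (double_vars ` F))
    (double_vars f * half_prod n 0)"
proof -
  let ?b = "half_prod n 0 - half_prod n 1 :: 'k mpol"
  let ?F = "insert ?b (double_vars ` F)"
  let ?I = "Idl\<^bsub>mpoly_ring n\<^esub> F" and ?J = "Idl\<^bsub>mpoly_ring (2 * n)\<^esub> ?F"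
  have gens: "minimal_homogeneous_generators n ?I F" and N: "(\<Sum>g\<in>F. card (Poly_Mapping.keys g)) = N"
    and f: "f \<in> carrier (mpoly_ring n)" "f \<notin> ?I" "\<And>i. i < n \<Longrightarrow> mvar i * f \<in> ?I"
    using ex by (auto simp: socle_example_def)
  have F: "finite F" "F \<subseteq> carrier (mpoly_ring n)" "\<And>g. g \<in> F \<Longrightarrow> homogeneous g"
    using gens by (auto simp: minimal_homogeneous_generators_def)
  have I: "ideal ?I (mpoly_ring n)" by (rule mpoly_Idl_ideal[OF F(2)])
  have b: "?b \<in> carrier (mpoly_ring (2 * n))"
    using mpoly_ring_add_closed[OF half_prod_closed mpoly_ring_uminus_closed[OF half_prod_closed], of 0 1 n]
    by simp
  have F': "double_vars ` A \<subseteq> carrier (mpoly_ring (2 * n))" if "A \<subseteq> F" for A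
    using F(2) that by (auto intro: double_vars_closed)
  have F'': "?F \<subseteq> carrier (mpoly_ring (2 * n))" using b F' by auto
  have J: "ideal ?J (mpoly_ring (2 * n))" by (rule mpoly_Idl_ideal[OF F''])
  \<comment> \<open>\<open>UNIV\<close> contains 0, so halving is a left inverse of the
    substitution.\<close>
  have inj: "inj (double_vars :: 'k mpol \<Rightarrow> 'k mpol)"
    by (rule injI) (metis halve_vars_double[OF n, of UNIV] UNIV_I)
  have dbl: "halve_vars n C (r * double_vars g) \<in> K"
    if "ideal K (mpoly_ring n)" "g \<in> K" "r \<in> carrier (mpoly_ring (2 * n))" for C r g and K :: "'k mpol set"
    using mpoly_ideal_mult[OF that(1) halve_vars_closed[OF that(3)] that(2)]
      halve_vars_double_mult[of n C g r] by (simp add: mult.commute)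
  have per: "halve_vars n C q \<in> Idl\<^bsub>mpoly_ring n\<^esub> A"
    if "A \<subseteq> F" "\<And>c. c + 2 \<in> C \<longleftrightarrow> c \<in> C"
      "q \<in> Idl\<^bsub>mpoly_ring (2 * n)\<^esub> (insert ?b (double_vars ` A))" for C q A
  proof (rule halve_vars_Idl[OF _ _ _ that(3)])
    have A: "A \<subseteq> carrier (mpoly_ring n)" using that(1) F(2) by blast
    show K: "ideal (Idl\<^bsub>mpoly_ring n\<^esub> A) (mpoly_ring n)" by (rule mpoly_Idl_ideal[OF A])
    show "insert ?b (double_vars ` A) \<subseteq> carrier (mpoly_ring (2 * n))" using b F'[OF that(1)] by auto
    fix g r :: "'k mpol" assume "g \<in> insert ?b (double_vars ` A)" "r \<in> carrier (mpoly_ring (2 * n))"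
    then show "halve_vars n C (r * g) \<in> Idl\<^bsub>mpoly_ring n\<^esub> A"
      using halve_vars_half_prod_diff[OF that(2), of n r] mpoly_ideal_zero[OF K] dbl[OF K]
        mpoly_Idl_self[OF A] by auto
  qed
  \<comment> \<open>The binomial survives under \<open>{1}\<close>: its first term has difference 1,
    its second -1.\<close>
  have halve_b: "halve_vars n {1} ?b = 1"
    by (simp add: halve_vars_diff halve_vars_half_prod[OF n] del: One_nat_def)
  have b_notin: "?b \<notin> Idl\<^bsub>mpoly_ring (2 * n)\<^esub> (double_vars ` F)"
  proof
    assume bI: "?b \<in> Idl\<^bsub>mpoly_ring (2 * n)\<^esub> (double_vars ` F)"
    have "halve_vars n {1} ?b \<in> ?I"
      by (rule halve_vars_Idl[OF I _ _ bI])
        (use F' dbl[OF I] mpoly_Idl_self[OF F(2)] in auto)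
    then have "1 \<in> ?I" unfolding halve_b .
    from mpoly_ideal_mult[OF I f(1) this] f(2) show False by simp
  qed
  then have b_new: "?b \<notin> double_vars ` F" using mpoly_Idl_self[OF F'] by blast
  have "minimal_homogeneous_generators (2 * n) ?J ?F"
  proof (rule minimal_homogeneous_generatorsI)
    fix g assume g: "g \<in> ?F"
    then show "homogeneous g"
      using homogeneous_half_prod_diff[OF n] F(3) by (auto intro: homogeneous_double_vars)
    show "g \<notin> Idl\<^bsub>mpoly_ring (2 * n)\<^esub> (?F - {g})"
    proof (cases "g = ?b")
      case True
      then show ?thesis using b_notin b_new by simp
    next
      case False
      then obtain g0 where g0: "g0 \<in> F" "g = double_vars g0" using g by blast
      then have "?F - {g} = insert ?b (double_vars ` (F - {g0}))"
        using False inj by (auto simp: inj_eq)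
      moreover have "halve_vars n {c. even c} g = g0"
        by (simp add: g0 halve_vars_double[OF n])
      ultimately show ?thesis
        using per[of "F - {g0}" "{c. even c}" g] minimal_homogeneous_generators_indep[OF gens g0(1)]
        by auto
    qed
  qed (use F(1) F'' in auto)
  moreover have "(\<Sum>g\<in>?F. card (Poly_Mapping.keys g)) = N + 2"
  proof -
    have "card (Poly_Mapping.keys ?b) = 2"
      using half_exp_neq[OF n] by (simp only: keys_half_prod_diff[OF n] card_2_iff) blast
    moreover have "(\<Sum>g\<in>double_vars ` F. card (Poly_Mapping.keys g)) = N"
      unfolding N[symmetric] sum.reindex[OF inj_on_subset[OF inj subset_UNIV]] comp_def
      by (simp add: keys_double_vars card_image[OF inj_on_subset[OF inj_double_exp subset_UNIV]])
    ultimately show ?thesis using b_new F(1) by simp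
  qed
  moreover have "double_vars f * half_prod n 0 \<in> carrier (mpoly_ring (2 * n))"
    by (intro mpoly_ring_mult_closed double_vars_closed half_prod_closed f) simp
  moreover have "double_vars f * half_prod n 0 \<notin> ?J"
  proof
    assume "double_vars f * half_prod n 0 \<in> ?J"
    from per[OF _ _ this, of "{c. odd c}"] f(2) show False
      by (simp add: halve_vars_double_mult halve_vars_half_prod[OF n])
  qed
  moreover have "mvar i * (double_vars f * half_prod n 0) \<in> ?J" if i: "i < 2 * n" for i
  proof -
    have bJ: "?b \<in> ?J" and FJ: "double_vars ` F \<subseteq> ?J" using mpoly_Idl_self[OF F''] by auto
    \<comment> \<open>The factor \<open>double_vars (mvar j)\<close> joins
      \<open>double_vars f\<close> to form the image of \<open>mvar j * f\<close>, an element of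
      \<open>?I\<close>.\<close>
    have socle: "double_vars f * (mvar (2 * j + (1 - r)) * half_prod n r) \<in> ?J"
      if "j < n" "r < 2" for j r
    proof -
      obtain w where w: "w \<in> carrier (mpoly_ring (2 * n))"
        "mvar (2 * j + (1 - r)) * half_prod n r = double_vars (mvar j) * (w :: 'k mpol)"
        using mvar_mult_half_prod[OF \<open>j < n\<close> \<open>r < 2\<close>] by blast
      have "w * double_vars (mvar j * f) \<in> ?J"
        by (intro mpoly_ideal_mult[OF J] w double_vars_Idl[OF J F(2) FJ] f that)
      moreover have "w * double_vars (mvar j * f) =
          double_vars f * (mvar (2 * j + (1 - r)) * half_prod n r)"
        unfolding w(2) double_vars_mult by (simp only: mult_ac)
      ultimately show ?thesis by simp
    qed
    show ?thesis
    proof (cases "even i")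
      \<comment> \<open>An even index is some \<open>x_j\<close>, which needs \<open>y_j\<close> as
        partner: modulo \<open>?b\<close> the product of the \<open>x_i\<close> is traded for that
        of the \<open>y_i\<close>. An odd index finds its partner directly.\<close>
      case True
      then obtain j where j: "i = 2 * j" by blast
      have "double_vars f * mvar i * ?b \<in> ?J"
        by (intro mpoly_ideal_mult[OF J] mpoly_ring_mult_closed double_vars_closed mvar_closed f i bJ)
      from mpoly_ideal_add[OF J this socle[of j 1]] i j show ?thesis
        by (simp add: algebra_simps)
    next
      case False
      then obtain j where j: "i = 2 * j + 1" by (elim oddE)
      then show ?thesis using socle[of j 0] i by (simp add: mult_ac)
    qed
  qed
  ultimately show ?thesis by (simp add: socle_example_def)
qed

lemma socle_example_exists:
  assumes "n > 0"
  shows "\<exists>F f. socle_example (2 ^ k * n) (n + 2 * k) F (f :: 'k::field mpol)"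
proof (induction k)
  case 0
  show ?case using socle_example_vars[of n] by auto
next
  case (Suc k)
  then obtain F and f :: "'k mpol" where "socle_example (2 ^ k * n) (n + 2 * k) F f" by blast
  from socle_example_double[OF _ this] assms show ?case by (auto simp: mult.assoc)
qed

theorem corollary4:
  fixes N :: nat and B :: real
  assumes "N \<ge> 2"
    and "\<And>n (I :: 'k::field mpol set).
           homogeneous_ideal n I \<Longrightarrow> has_monomial_support n I N \<Longrightarrow>
           proj_dim (mpoly_ring n) (quotient_module (mpoly_ring n) I) \<le> ereal B"
  shows "B \<ge> 2 powr (real N / 2)"
proof -
  have bound: "real n \<le> B" if ex: "socle_example n N F (f :: 'k mpol)" for n F f
  proof -
    let ?I = "Idl\<^bsub>mpoly_ring n\<^esub> F"
    have gens: "minimal_homogeneous_generators n ?I F" using ex by (simp add: socle_example_def)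
    then have F: "F \<subseteq> carrier (mpoly_ring n)" "\<forall>f\<in>F. homogeneous f"
      by (auto simp: minimal_homogeneous_generators_def)
    have "homogeneous_ideal n ?I" unfolding homogeneous_ideal_def using F by blast
    moreover have "has_monomial_support n ?I N"
      unfolding has_monomial_support_def using gens ex by (auto simp: socle_example_def)
    ultimately have "proj_dim (mpoly_ring n) (quotient_module (mpoly_ring n) ?I) \<le> ereal B"
      by (rule assms(2))
    moreover have "ereal (real n) \<le> proj_dim (mpoly_ring n) (quotient_module (mpoly_ring n) ?I)"
      using ex by (intro proj_dim_quotient_ge[of _ n f] mpoly_Idl_ideal F) (auto simp: socle_example_def)
    ultimately show ?thesis using order_trans by fastforce
  qed
  \<comment> \<open>For \<open>N = 2 + 2 * k\<close> the example has \<open>2 ^ k * 2\<close>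
    variables, exactly the bound. For \<open>N = 3 + 2 * k\<close> it has \<open>2 ^ k * 3\<close>,
    and 3 exceeds \<open>2 powr (3 / 2)\<close>, whose square is 8.\<close>
  show ?thesis
  proof (cases "even N")
    case True
    with assms(1) obtain k where k: "N = 2 + 2 * k"
      by (metis dvd_def le_add_diff_inverse dvd_diff_nat dvd_refl)
    then obtain F and f :: "'k mpol" where "socle_example (2 ^ k * 2) N F f"
      using socle_example_exists[of 2 k] by auto
    moreover have "(2::real) powr (real N / 2) = 2 ^ k * 2"
      by (simp add: k add_divide_distrib powr_add powr_realpow)
    ultimately show ?thesis using bound by fastforce
  next
    case False
    with assms(1) have "N \<ge> 3" "even (N - 3)" by presburger+
    then obtain k where k: "N = 3 + 2 * k"
      by (metis dvd_def le_add_diff_inverse)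
    then obtain F and f :: "'k mpol" where "socle_example (2 ^ k * 3) N F f"
      using socle_example_exists[of 3 k] by auto
    then have B: "2 ^ k * 3 \<le> B" using bound by fastforce
    have "(2::real) powr (3 / 2) \<le> 3"
    proof (rule power2_le_imp_le)
      show "((2::real) powr (3 / 2))\<^sup>2 \<le> 3\<^sup>2"
        by (simp add: power2_eq_square powr_add[symmetric])
    qed simp
    then have "(2::real) powr (real N / 2) \<le> 2 ^ k * 3"
      by (simp add: k add_divide_distrib powr_add powr_realpow)
    with B show ?thesis by linarith
  qed
qed

end
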